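(* Let $\delta>-1$, let $(\mathcal{T}_n)_{n\ge1}$ be the self-reinforced preferential attachment trees with parameter $\delta$, and let $$\phi(\delta)=\tfrac12\big(1+\tfrac12\delta\big)\Big[1+\sqrt{1+4\big(1+\tfrac12\delta\big)^{-1}}\,\Big].$$ For every $i\ge1$ there exists an $L^1$ random variable $\zeta_i$ with $\mathbb{E}(\zeta_i)>0$ such that, as $n\to\infty$, $$n^{-1/\phi(\delta)}\,d(v_i,n)\to\zeta_i\quad\text{almost surely and in }L^1 .$$
   Context: Fix $\delta>-1$. $\mathcal{T}_n$ is a random tree on vertices $v_0,\dots,v_n$ (the whole sequence being defined on one probability space). $\mathcal{T}_1$ is the single edge $\{v_0,v_1\}$, and by convention $\mathcal{T}_0=\mathcal{T}_1$. Let $d(v_i,m)$ be the degree of $v_i$ in $\mathcal{T}_m$ for $m\ge i$ (by the convention, $d(v_0,0)=1$), and let $$\theta(v_i,n)=\sum_{m=i}^{n}\big(d(v_i,m)+\delta\big),\qquad 0\le i\le n .$$ For $n\ge1$, given $\mathcal{T}_1,\dots,\mathcal{T}_n$, the tree $\mathcal{T}_{n+1}$ is obtained by attaching the new vertex $v_{n+1}$ by a single edge to $v_i$ with conditional probability $\theta(v_i,n)/\sum_{j=0}^n\theta(v_j,n)$, $0\le i\le n$. *)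

theory Defs
  imports "HOL-Probability.Probability"
begin

text \<open>The vertex \<open>v\<^sub>i\<close> is the natural number \<open>i\<close>, and a tree on \<open>v\<^sub>0, \<dots>, v\<^sub>n\<close> (\<open>n \<ge> 1\<close>) is
  given by its set of edges, each edge being a two-element set of vertices. As such a tree has no
  isolated vertices, its vertex set is the union of its edges.\<close>

definition vdeg :: "nat set set \<Rightarrow> nat \<Rightarrow> nat" where
  "vdeg E v = card {e \<in> E. v \<in> e}"

definition theta :: "real \<Rightarrow> (nat \<Rightarrow> nat set set) \<Rightarrow> nat \<Rightarrow> nat \<Rightarrow> real" where
  "theta \<delta> t i n = (\<Sum>m = i..n. (real (vdeg (t m) i) + \<delta>))"

definition attach :: "nat set set \<Rightarrow> nat \<Rightarrow> nat \<Rightarrow> nat set set" where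
  "attach E w v = insert {w, v} E"

text \<open>The trees take values in a discrete space, so conditioning on \<open>T\<^sub>1, \<dots>, T\<^sub>n\<close> is conditioning on
  each history \<open>t\<close> of positive probability. The deterministic tree \<open>T\<^sub>0 = T\<^sub>1\<close> is included in the
  history because \<^term>\<open>theta\<close> refers to it; this does not change the conditioning.\<close>

locale self_reinforced_pa_trees = prob_space M
  for M :: "'a measure" and \<delta> :: real and T :: "nat \<Rightarrow> 'a \<Rightarrow> nat set set" +
  assumes T_measurable: "\<And>n. T n \<in> measurable M (count_space UNIV)"
    and T_0: "\<And>\<omega>. \<omega> \<in> space M \<Longrightarrow> T 0 \<omega> = T 1 \<omega>"
    and T_1: "\<And>\<omega>. \<omega> \<in> space M \<Longrightarrow> T 1 \<omega> = {{0, 1}}"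
    and T_Suc: "\<And>n \<omega>. n \<ge> 1 \<Longrightarrow> \<omega> \<in> space M \<Longrightarrow> \<exists>i\<le>n. T (Suc n) \<omega> = attach (T n \<omega>) (Suc n) i"
    and cond_prob_T_Suc: "\<And>n i t. n \<ge> 1 \<Longrightarrow> i \<le> n \<Longrightarrow>
      0 < \<P>(\<omega> in M. \<forall>m\<le>n. T m \<omega> = t m) \<Longrightarrow>
      \<P>(\<omega> in M. T (Suc n) \<omega> = attach (T n \<omega>) (Suc n) i \<bar> \<forall>m\<le>n. T m \<omega> = t m)
        = theta \<delta> t i n / (\<Sum>j\<le>n. theta \<delta> t j n)"

definition phi :: "real \<Rightarrow> real" where
  "phi \<delta> = 1/2 * (1 + 1/2 * \<delta>) * (1 + sqrt (1 + 4 * inverse (1 + 1/2 * \<delta>)))"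

end

theory Submission
  imports Defs "HOL-Real_Asymp.Real_Asymp" "HOL-Computational_Algebra.Nth_Powers"
begin

text \<open>
  Write \<open>X\<^sub>n\<close> for \<open>d(v\<^sub>i, n) + \<delta>\<close>, \<open>\<Theta>\<^sub>n\<close> for \<open>\<theta>(v\<^sub>i, n)\<close> and \<open>c\<close> for \<open>1 + \<delta> / 2\<close>. A tree with \<open>m\<close> edges has total
  degree \<open>2 m\<close>, so the total weight of the vertices at time \<open>n\<close> is a deterministic quadratic polynomial
  \<open>S\<^sub>n\<close>, asymptotic to \<open>c n\<^sup>2\<close>. Hence \<open>(X, \<Theta>)\<close> is a linear stochastic recursion: the conditional mean of
  \<open>X\<^sub>n\<^sub>+\<^sub>1\<close> is \<open>X\<^sub>n + \<Theta>\<^sub>n / S\<^sub>n\<close>, and \<open>\<Theta>\<^sub>n\<^sub>+\<^sub>1 = \<Theta>\<^sub>n + X\<^sub>n\<^sub>+\<^sub>1\<close>. Its continuous analogue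
  \<open>\<Theta>'' = \<Theta> / (c t\<^sup>2)\<close> has the solutions \<open>t\<close> to the power \<open>1 + \<alpha>\<close> and \<open>t\<close> to the power \<open>- \<alpha>\<close>, where
  \<open>\<alpha> > 0\<close> solves \<open>\<alpha> (1 + \<alpha>) c = 1\<close>. That root is \<open>1 / \<phi>(\<delta>)\<close>, and \<open>\<delta> > -1\<close> makes it less than \<open>1\<close>
  (\<open>inverse_phi\<close>).

  The functional that annihilates the second solution,
  \<open>L\<^sub>n = a\<^sub>n X\<^sub>n + b\<^sub>n \<Theta>\<^sub>n\<close> with \<open>a\<^sub>n = n powr (- \<alpha>)\<close> and \<open>b\<^sub>n = \<alpha> n powr (- \<alpha> - 1)\<close>, is nearly a
  martingale. Since \<open>X\<close> and \<open>\<Theta>\<close> are positive, both its drift and its conditional variance are at most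
  a constant times \<open>(a\<^sub>n - a\<^sub>n\<^sub>+\<^sub>1) L\<^sub>n\<close> (\<open>drift_control_exists\<close>), and the factors \<open>a\<^sub>n - a\<^sub>n\<^sub>+\<^sub>1\<close>
  telescope. So the second moments of \<open>L\<^sub>n\<close> stay bounded, \<open>E (L\<^sub>m - L\<^sub>n)\<^sup>2\<close> is at most a constant times
  \<open>a\<^sub>n\<close> for \<open>m \<ge> n\<close>, and \<open>E L\<^sub>n\<close> stays away from \<open>0\<close> (\<open>square_increment_bound\<close>,
  \<open>expectation_L_bounded_below\<close>).

  Along the times \<open>k ^ p\<close> with \<open>p\<close> large, the \<open>L\<^sup>1\<close> norms of the increments of \<open>L\<close> are therefore
  summable, so \<open>L\<close> converges almost surely along this subsequence. Because
  \<open>n powr (1 + \<alpha>) * L\<^sub>n = n X\<^sub>n + \<alpha> \<Theta>\<^sub>n\<close> is increasing in \<open>n\<close>, and consecutive times \<open>k ^ p\<close> have ratios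
  tending to \<open>1\<close>, the gaps fill up and the whole sequence converges almost surely
  (\<open>tendsto_of_power_subsequence\<close>, \<open>L_limit\<close>). This takes the place of a maximal inequality.

  It remains to recover \<open>X\<close> from \<open>L\<close>. The normalised weight \<open>W\<^sub>n = \<Theta>\<^sub>n / n powr (1 + \<alpha>)\<close> is, up to
  small errors, a weighted running average of the values of \<open>L\<close>. If \<open>L\<^sub>n\<close> tends to \<open>l\<close>, then \<open>W\<^sub>n\<close> tends to
  \<open>l / (1 + 2 \<alpha>)\<close>, by a recursive inequality for the error that can be used path by path as well as
  after taking expectations (\<open>W_error_recursion\<close>). Thus \<open>n powr (- \<alpha>) * X\<^sub>n = L\<^sub>n - \<alpha> W\<^sub>n\<close> tends to
  \<open>\<zeta> = l (1 + \<alpha>) / (1 + 2 \<alpha>)\<close>, almost surely and in \<open>L\<^sup>1\<close>.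
\<close>

section \<open>Real sequences\<close>

text \<open>Summing the inequality shows that \<open>u n\<close> is at most an average of the first \<open>n\<close> values of \<open>\<eta>\<close>, up
  to a multiple of \<open>1 / n\<close>; so this is a form of Cesaro's theorem.\<close>

lemma averaging_recursion_tendsto_0:
  fixes u \<eta> :: "nat \<Rightarrow> real"
  assumes step: "\<And>n. n \<ge> N \<Longrightarrow> real (Suc n) * u (Suc n) \<le> real n * u n + \<eta> n"
    and nonneg: "\<And>n. n \<ge> N \<Longrightarrow> 0 \<le> u n" and \<eta>: "\<eta> \<longlonglongrightarrow> 0"
  shows "u \<longlonglongrightarrow> 0"
proof (rule LIMSEQ_I)
  fix \<epsilon> :: real assume "0 < \<epsilon>"
  then have "\<forall>\<^sub>F n in sequentially. \<eta> n < \<epsilon> / 2" using order_tendstoD(2)[OF \<eta>, of "\<epsilon> / 2"] by simp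
  then obtain K0 where K0: "\<And>n. n \<ge> K0 \<Longrightarrow> \<eta> n < \<epsilon> / 2" by (auto simp: eventually_sequentially)
  define K where "K = max N K0"
  define A where "A = real K * u K"
  have bound: "real n * u n \<le> A + real (n - K) * (\<epsilon> / 2)" if "n \<ge> K" for n
    using that
  proof (induction n rule: nat_induct_at_least)
    case base
    then show ?case by (simp add: A_def)
  next
    case (Suc n)
    have "real (Suc n) * u (Suc n) \<le> real n * u n + \<epsilon> / 2"
      using step[of n] K0[of n] Suc.hyps by (simp add: K_def)
    also have "\<dots> \<le> A + real (Suc n - K) * (\<epsilon> / 2)"
    proof -
      have "real (Suc n - K) * (\<epsilon> / 2) = real (n - K) * (\<epsilon> / 2) + \<epsilon> / 2"
        using Suc.hyps by (simp only: Suc_diff_le of_nat_Suc distrib_right mult_1_left)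
      then show ?thesis using Suc.IH by linarith
    qed
    finally show ?case .
  qed
  have "(\<lambda>n. A / real n) \<longlonglongrightarrow> 0" by real_asymp
  then have "\<forall>\<^sub>F n in sequentially. A / real n < \<epsilon> / 2"
    using order_tendstoD(2) \<open>0 < \<epsilon>\<close> half_gt_zero by blast
  then obtain K1 where K1: "\<And>n. n \<ge> K1 \<Longrightarrow> A / real n < \<epsilon> / 2" by (auto simp: eventually_sequentially)
  have "norm (u n - 0) < \<epsilon>" if "n \<ge> max 1 (max K K1)" for n
  proof -
    have n: "n \<ge> K" "n \<ge> K1" "n \<ge> N" "real n > 0" using that by (auto simp: K_def)
    have "real n * u n \<le> A + real n * (\<epsilon> / 2)"
    proof -
      have "real (n - K) * (\<epsilon> / 2) \<le> real n * (\<epsilon> / 2)"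
        using \<open>0 < \<epsilon>\<close> by (intro mult_right_mono) auto
      then show ?thesis using bound[OF n(1)] by linarith
    qed
    then have "u n \<le> A / real n + \<epsilon> / 2" using n(4) by (simp add: field_simps)
    then have "u n < \<epsilon>" using K1[OF n(2)] by linarith
    then show ?thesis using nonneg[OF n(3)] by simp
  qed
  then show "\<exists>no. \<forall>n\<ge>no. norm (u n - 0) < \<epsilon>" by blast
qed

lemma filterlim_nth_root_nat: "p > 0 \<Longrightarrow> filterlim (nth_root_nat p) at_top at_top"
  unfolding filterlim_at_top eventually_at_top_linorder
  by (intro allI exI[of _ "Z ^ p" for Z] impI nth_root_nat_ge)

text \<open>For \<open>n\<close> between \<open>k ^ p\<close> and \<open>Suc k ^ p\<close>, monotonicity traps \<open>f n / n powr \<beta>\<close> between the quotients at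
  the two ends, with numerator and denominator taken at opposite ends. The ratio of the two
  denominators tends to \<open>1\<close>.\<close>

lemma tendsto_of_power_subsequence:
  fixes f :: "nat \<Rightarrow> real"
  assumes nonneg: "\<And>n. n \<ge> N \<Longrightarrow> 0 \<le> f n" and mono: "\<And>m n. N \<le> m \<Longrightarrow> m \<le> n \<Longrightarrow> f m \<le> f n"
    and "p > 0" "\<beta> \<ge> 0"
    and lim: "(\<lambda>k. f (k ^ p) / real (k ^ p) powr \<beta>) \<longlonglongrightarrow> l"
  shows "(\<lambda>n. f n / real n powr \<beta>) \<longlonglongrightarrow> l"
proof -
  let ?k = "nth_root_nat p"
  let ?g = "\<lambda>k. f (k ^ p) / real (k ^ p) powr \<beta>"
  let ?r = "\<lambda>k. ((real k / real (Suc k)) ^ p) powr \<beta>"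
  have "(\<lambda>k. real k / real (Suc k)) \<longlonglongrightarrow> 1" by real_asymp
  then have "?r \<longlonglongrightarrow> (1 ^ p) powr \<beta>" by (intro tendsto_intros) auto
  then have r: "?r \<longlonglongrightarrow> 1" by simp
  have "(\<lambda>k. ?g k * ?r k) \<longlonglongrightarrow> l * 1" by (intro tendsto_mult lim r)
  then have "(\<lambda>k. ?g k * ?r k) \<longlonglongrightarrow> l" by (simp only: mult_1_right)
  from filterlim_compose[OF this filterlim_nth_root_nat[OF \<open>p > 0\<close>]]
  have lower: "(\<lambda>n. ?g (?k n) * ?r (?k n)) \<longlonglongrightarrow> l" .
  have "(\<lambda>k. ?g (Suc k) / ?r k) \<longlonglongrightarrow> l / 1"
    by (rule tendsto_divide[OF LIMSEQ_Suc[OF lim] r]) simp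
  then have "(\<lambda>k. ?g (Suc k) / ?r k) \<longlonglongrightarrow> l" by (simp only: div_by_1)
  from filterlim_compose[OF this filterlim_nth_root_nat[OF \<open>p > 0\<close>]]
  have upper: "(\<lambda>n. ?g (Suc (?k n)) / ?r (?k n)) \<longlonglongrightarrow> l" .
  have ev: "\<forall>\<^sub>F n in sequentially. n \<ge> 1 \<and> ?k n \<ge> max 1 N"
    using filterlim_nth_root_nat[OF \<open>p > 0\<close>]
    by (intro eventually_conj eventually_ge_at_top) (simp only: filterlim_at_top)
  have sandwich: "?g k * ?r k \<le> f n / real n powr \<beta> \<and> f n / real n powr \<beta> \<le> ?g (Suc k) / ?r k"
    if k: "k = ?k n" and n: "n \<ge> 1" "k \<ge> max 1 N" for n k
  proof -
    have le: "k ^ p \<le> n" using \<open>p > 0\<close> nth_root_nat_power_le k by simp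
    have less: "n < Suc k ^ p"
      using nth_root_nat_ge[OF \<open>p > 0\<close>, of "Suc k" n] k by force
    have "k \<le> k ^ p" using \<open>p > 0\<close> n by (simp add: self_le_power)
    then have kN: "N \<le> k ^ p" using n by simp
    have pos: "0 < real n powr \<beta>" "0 < real (k ^ p) powr \<beta>" "0 < real (Suc k ^ p) powr \<beta>"
      using n by auto
    have pw: "real (k ^ p) powr \<beta> \<le> real n powr \<beta>" "real n powr \<beta> \<le> real (Suc k ^ p) powr \<beta>"
      using le less \<open>\<beta> \<ge> 0\<close> by (intro powr_mono2; simp only: of_nat_le_iff of_nat_0_le_iff; simp)+
    have r_eq: "?r k = real (k ^ p) powr \<beta> / real (Suc k ^ p) powr \<beta>"
      by (simp add: power_divide powr_divide)
    have "?g k * ?r k = f (k ^ p) / real (Suc k ^ p) powr \<beta>"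
      using pos unfolding r_eq by simp
    also have "\<dots> \<le> f n / real n powr \<beta>"
      using pos pw nonneg[of "k ^ p"] mono[of "k ^ p" n] kN le by (intro frac_le) auto
    finally have 1: "?g k * ?r k \<le> f n / real n powr \<beta>" .
    have 2: "f n / real n powr \<beta> \<le> f (Suc k ^ p) / real (k ^ p) powr \<beta>"
      using pos pw nonneg[of "Suc k ^ p"] mono[of n "Suc k ^ p"] kN le less by (intro frac_le) auto
    have 3: "f (Suc k ^ p) / real (k ^ p) powr \<beta> = ?g (Suc k) / ?r k"
      using pos unfolding r_eq by simp
    show ?thesis using 1 2 unfolding 3 by blast
  qed
  show ?thesis
  proof (rule tendsto_sandwich[OF _ _ lower upper])
    show "\<forall>\<^sub>F n in sequentially. ?g (?k n) * ?r (?k n) \<le> f n / real n powr \<beta>"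
      by (rule eventually_mono[OF ev]) (use sandwich[OF refl] in blast)
    show "\<forall>\<^sub>F n in sequentially. f n / real n powr \<beta> \<le> ?g (Suc (?k n)) / ?r (?k n)"
      by (rule eventually_mono[OF ev]) (use sandwich[OF refl] in blast)
  qed
qed

lemma bigo_eventually_le:
  fixes f g :: "nat \<Rightarrow> real"
  assumes "f \<in> O(g)" "\<And>n. n \<ge> 1 \<Longrightarrow> 0 \<le> g n"
  obtains C where "C > 0" "\<forall>\<^sub>F n in sequentially. \<bar>f n\<bar> \<le> C * g n"
proof -
  obtain C where C: "C > 0" "\<forall>\<^sub>F n in sequentially. norm (f n) \<le> C * norm (g n)"
    using landau_o.bigE[OF assms(1)] by blast
  have "\<forall>\<^sub>F n in sequentially. \<bar>f n\<bar> \<le> C * g n"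
    using C(2) eventually_ge_at_top[of 1] by eventually_elim (use assms(2) in simp)
  then show ?thesis using that C(1) by blast
qed

section \<open>The exponent and the asymptotics of the coefficients\<close>

text \<open>The number \<open>\<phi>(\<delta>)\<close> is the positive root of \<open>x\<^sup>2 = c (x + 1)\<close> with \<open>c = 1 + \<delta> / 2\<close>. The bound
  \<open>\<alpha> < 1\<close> is where \<open>\<delta> > -1\<close> enters: then \<open>\<alpha> (1 + \<alpha>) = 1 / c < 2\<close>.\<close>

lemma inverse_phi:
  assumes "\<delta> > -1"
  defines "\<alpha> \<equiv> 1 / phi \<delta>"
  shows "0 < \<alpha>" "\<alpha> < 1" "\<alpha> * (1 + \<alpha>) * (1 + \<delta> / 2) = 1"
proof -
  define c where "c = 1 + \<delta> / 2"
  have c: "c > 1 / 2" using assms by (simp add: c_def)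
  define s where "s = sqrt (1 + 4 / c)"
  have phi: "phi \<delta> = c / 2 * (1 + s)"
    unfolding phi_def s_def c_def divide_inverse by (simp only: mult.commute mult_1_left)
  have s2: "s^2 = 1 + 4 / c" using c by (simp add: s_def)
  have "s > 1" using c by (simp add: s_def)
  then have phi_pos: "phi \<delta> > 0" using c by (simp add: phi)
  have "phi \<delta> ^ 2 = c * (c * (1 + 2 * s + s^2)) / 4" by (simp add: phi power2_eq_square field_simps)
  also have "c * (1 + 2 * s + s^2) = 4 * (phi \<delta> + 1)" using c by (simp add: s2 phi field_simps)
  finally have eq: "phi \<delta> ^ 2 = c * (phi \<delta> + 1)" by (simp add: field_simps)
  show "0 < \<alpha>" using phi_pos by (simp add: \<alpha>_def)
  have "\<alpha> * (1 + \<alpha>) * c = c * (phi \<delta> + 1) / phi \<delta> ^ 2"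
    using phi_pos by (simp add: \<alpha>_def power2_eq_square field_simps)
  also have "\<dots> = 1" unfolding eq[symmetric] using phi_pos by simp
  finally show *: "\<alpha> * (1 + \<alpha>) * (1 + \<delta> / 2) = 1" by (simp only: c_def)
  show "\<alpha> < 1"
  proof (rule ccontr)
    assume "\<not> \<alpha> < 1"
    then have "1 * 2 \<le> \<alpha> * (1 + \<alpha>)" by (intro mult_mono) auto
    then have "2 * c \<le> \<alpha> * (1 + \<alpha>) * c" using c by (intro mult_right_mono) auto
    then show False using * c by (simp add: c_def)
  qed
qed

text \<open>The value of \<open>\<theta>(v\<^sub>0, n) + \<dots> + \<theta>(v\<^sub>n, n)\<close>. The summand \<open>1\<close> is the degree of \<open>v\<^sub>0\<close> at time \<open>0\<close>: by the
  convention \<open>T\<^sub>0 = T\<^sub>1\<close>, that degree is \<open>1\<close> and not \<open>0\<close>.\<close>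

definition total_weight :: "real \<Rightarrow> nat \<Rightarrow> real" where
  "total_weight \<delta> n = 1 + real n * (real n + 1) + \<delta> * (real n + 1) * (real n + 2) / 2"

lemma total_weight_pos:
  assumes "\<delta> > -1"
  shows "total_weight \<delta> n > 0"
proof -
  have "total_weight \<delta> n = (1 + \<delta>) * ((real n + 1) * (real n + 2) / 2) + real n * (real n - 1) / 2"
    by (simp add: total_weight_def field_simps)
  moreover have "real n * (real n - 1) / 2 \<ge> 0" by (cases n) auto
  ultimately show ?thesis using assms by (simp add: add_pos_nonneg)
qed

text \<open>The next three estimates are the coefficients of \<open>X\<close> and of \<open>\<Theta>\<close> in the drift of the approximate
  martingale, and of \<open>\<Theta>\<close> in the bound for its conditional variance. Each is compared with
  \<open>a\<^sub>n - a\<^sub>n\<^sub>+\<^sub>1\<close>, of order \<open>n powr (- \<alpha> - 1)\<close>, times the corresponding coefficient of the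
  approximate martingale itself. The drift coefficients are smaller than those by a factor of order
  \<open>1 / n\<^sup>2\<close>, and \<open>\<alpha> < 1\<close> is what makes that factor \<open>O(a\<^sub>n - a\<^sub>n\<^sub>+\<^sub>1)\<close>.\<close>

lemma drift_coefficient_X:
  fixes \<alpha> :: real
  assumes "0 < \<alpha>" "\<alpha> < 1"
  shows "(\<lambda>n::nat. real (Suc n) powr -\<alpha> + \<alpha> * real (Suc n) powr (-\<alpha>-1) - real n powr -\<alpha>) \<in>
      O(\<lambda>n. (real n powr -\<alpha> - real (Suc n) powr -\<alpha>) * real n powr -\<alpha>)"
  using assms by real_asymp

text \<open>To leading order this is \<open>n powr (- \<alpha> - 2) * (1 / c - \<alpha> (\<alpha> + 1))\<close>, and the equation for \<open>\<alpha>\<close> cancels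
  it. To make the cancellation visible, \<open>total_weight\<close> is replaced by \<open>c n\<^sup>2\<close>, and the two
  remaining expressions are compared with their leading terms separately.\<close>

lemma drift_coefficient_Theta:
  fixes \<alpha> \<delta> :: real
  assumes "0 < \<alpha>" "\<alpha> < 1" "\<alpha> * (1 + \<alpha>) * (1 + \<delta> / 2) = 1"
  shows "(\<lambda>n::nat. (real (Suc n) powr -\<alpha> + \<alpha> * real (Suc n) powr (-\<alpha>-1)) / total_weight \<delta> n
      + \<alpha> * real (Suc n) powr (-\<alpha>-1) - \<alpha> * real n powr (-\<alpha>-1)) \<in>
      O(\<lambda>n. (real n powr -\<alpha> - real (Suc n) powr -\<alpha>) * (\<alpha> * real n powr (-\<alpha>-1)))"
    (is "?lhs \<in> O(?target)")
proof -
  let ?K = "\<alpha> * (1 + \<alpha>)" and ?R = "\<lambda>n::nat. real (Suc n) powr -\<alpha> + \<alpha> * real (Suc n) powr (-\<alpha>-1)"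
  let ?S = "total_weight \<delta>"
  define k where "k = 1 + \<delta> / 2"
  have K: "?K > 0" using assms by simp
  have k: "k > 0" using assms(3) K by (metis k_def zero_less_mult_pos zero_less_one)
  have kK: "1 / k = ?K" using assms(3) k by (simp add: k_def field_simps)
  have S: "?S n = 1 + real n * (real n + 1) + (k - 1) * (real n + 1) * (real n + 2)" for n
    by (simp add: total_weight_def k_def field_simps)
  have "(\<lambda>n. 1 / ?S n - 1 / (k * real n ^ 2)) \<in> O(\<lambda>n. 1 / real n ^ 3)"
    unfolding S using k by real_asymp
  then have "(\<lambda>n. ?R n * (1 / ?S n - 1 / (k * real n ^ 2))) \<in> O(\<lambda>n. ?R n * (1 / real n ^ 3))"
    by (intro landau_o.big.mult) auto
  also have "(\<lambda>n. ?R n * (1 / real n ^ 3)) \<in> O(\<lambda>n. real n powr (-3 - \<alpha>))"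
    using assms(1,2) by real_asymp
  finally have 1: "(\<lambda>n. ?R n * (1 / ?S n - 1 / (k * real n ^ 2))) \<in> O(\<lambda>n. real n powr (-3 - \<alpha>))" .
  have "(\<lambda>n. ?R n / real n ^ 2 - real n powr (-\<alpha>-2)) \<in> O(\<lambda>n. real n powr (-3 - \<alpha>))"
    using assms(1,2) by real_asymp
  then have 2: "(\<lambda>n. ?K * (?R n / real n ^ 2 - real n powr (-\<alpha>-2))) \<in> O(\<lambda>n. real n powr (-3 - \<alpha>))"
    using K by simp
  have "(\<lambda>n::nat. real (Suc n) powr (-\<alpha>-1) - real n powr (-\<alpha>-1) + (1 + \<alpha>) * real n powr (-\<alpha>-2)) \<in>
      O(\<lambda>n. real n powr (-3 - \<alpha>))"
    using assms(1,2) by real_asymp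
  then have 3: "(\<lambda>n. \<alpha> * (real (Suc n) powr (-\<alpha>-1) - real n powr (-\<alpha>-1) + (1 + \<alpha>) * real n powr (-\<alpha>-2))) \<in>
      O(\<lambda>n. real n powr (-3 - \<alpha>))"
    using assms(1) by simp
  have sum: "?lhs = (\<lambda>n. ?R n * (1 / ?S n - 1 / (k * real n ^ 2)) +
      ?K * (?R n / real n ^ 2 - real n powr (-\<alpha>-2)) +
      \<alpha> * (real (Suc n) powr (-\<alpha>-1) - real n powr (-\<alpha>-1) + (1 + \<alpha>) * real n powr (-\<alpha>-2)))"
  proof
    fix n :: nat
    have distr: "r * (1 / s - 1 / (k * q)) = r / s - 1 / k * (r / q)" for r s q :: real
      by (simp add: right_diff_distrib)
    have split: "?R n * (1 / ?S n - 1 / (k * real n ^ 2)) = ?R n / ?S n - ?K * (?R n / real n ^ 2)"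
      unfolding kK[symmetric] by (rule distr)
    show "?lhs n = ?R n * (1 / ?S n - 1 / (k * real n ^ 2)) +
      ?K * (?R n / real n ^ 2 - real n powr (-\<alpha>-2)) +
      \<alpha> * (real (Suc n) powr (-\<alpha>-1) - real n powr (-\<alpha>-1) + (1 + \<alpha>) * real n powr (-\<alpha>-2))"
      unfolding split by (simp only: right_diff_distrib distrib_left mult.assoc) (simp add: distrib_left)
  qed
  have "?lhs \<in> O(\<lambda>n. real n powr (-3 - \<alpha>))"
    unfolding sum by (intro sum_in_bigo 1 2 3)
  also have "(\<lambda>n. real n powr (-3 - \<alpha>)) \<in> O(?target)"
    using assms(1,2) by real_asymp
  finally show ?thesis .
qed

lemma noise_coefficient:
  fixes \<alpha> \<delta> :: real
  assumes "0 < \<alpha>" "\<alpha> < 1" "\<delta> > -1"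
  shows "(\<lambda>n::nat. (real (Suc n) powr -\<alpha> + \<alpha> * real (Suc n) powr (-\<alpha>-1))^2 / total_weight \<delta> n) \<in>
      O(\<lambda>n. (real n powr -\<alpha> - real (Suc n) powr -\<alpha>) * (\<alpha> * real n powr (-\<alpha>-1)))"
proof -
  have "2 + \<delta> > 0" using assms by simp
  then show ?thesis unfolding total_weight_def using assms(1,2) by real_asymp
qed

text \<open>The expansion \<open>1 - (1 + \<alpha>) / n\<close> of the power shows where \<open>1 + 2 \<alpha>\<close> comes from.\<close>

lemma theta_recursion_coefficient:
  fixes \<alpha> :: real
  assumes "0 < \<alpha>" "\<alpha> < 1"
  shows "(\<lambda>n::nat. real (Suc n) * (1 + \<alpha> / real (Suc n) - (real n / real (Suc n)) powr (1 + \<alpha>)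
      - (1 + 2 * \<alpha>) / real (Suc n))) \<longlonglongrightarrow> 0"
  using assms by real_asymp

section \<open>Degrees and total weight of the trees\<close>

lemma vdeg_attach:
  assumes "finite E" "\<And>e. e \<in> E \<Longrightarrow> w \<notin> e" "v \<noteq> w"
  shows "vdeg (attach E w v) u = vdeg E u + (if u = v \<or> u = w then 1 else 0)"
proof -
  have new: "{w, v} \<notin> E" using assms(2) by blast
  have "{e \<in> attach E w v. u \<in> e} =
      (if u = v \<or> u = w then insert {w, v} {e \<in> E. u \<in> e} else {e \<in> E. u \<in> e})"
    by (auto simp: attach_def)
  then show ?thesis using assms(1) new by (simp add: vdeg_def)
qed

lemma theta_Suc: "j \<le> Suc n \<Longrightarrow> theta \<delta> t j (Suc n) = theta \<delta> t j n + (real (vdeg (t (Suc n)) j) + \<delta>)"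
  by (simp add: theta_def add.commute)

context self_reinforced_pa_trees
begin

lemma T_edges:
  assumes "n \<ge> 1" "\<omega> \<in> space M"
  shows "T n \<omega> \<subseteq> Pow {..n}"
  using assms(1)
proof (induction n rule: nat_induct_at_least)
  case base
  show ?case using T_1[OF assms(2)] by auto
next
  case (Suc n)
  obtain j where j: "j \<le> n" "T (Suc n) \<omega> = attach (T n \<omega>) (Suc n) j"
    using T_Suc[OF Suc.hyps assms(2)] by auto
  have "Pow {..n} \<subseteq> Pow {..Suc n}" by auto
  then show ?case using Suc.IH j by (auto simp: attach_def)
qed

lemma T_vertices: "n \<ge> 1 \<Longrightarrow> \<omega> \<in> space M \<Longrightarrow> e \<in> T n \<omega> \<Longrightarrow> u \<in> e \<Longrightarrow> u \<le> n"
  using T_edges[of n \<omega>] by blast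

lemma finite_T: "n \<ge> 1 \<Longrightarrow> \<omega> \<in> space M \<Longrightarrow> finite (T n \<omega>)"
  by (rule finite_subset[OF T_edges]) auto

lemma vdeg_T_Suc:
  assumes "n \<ge> 1" "\<omega> \<in> space M"
  obtains v where "v \<le> n" "T (Suc n) \<omega> = attach (T n \<omega>) (Suc n) v"
    "\<And>u. vdeg (T (Suc n) \<omega>) u = vdeg (T n \<omega>) u + (if u = v \<or> u = Suc n then 1 else 0)"
proof -
  obtain v where v: "v \<le> n" "T (Suc n) \<omega> = attach (T n \<omega>) (Suc n) v"
    using T_Suc[OF assms] by auto
  have "Suc n \<notin> e" if "e \<in> T n \<omega>" for e using T_vertices[OF assms that] by fastforce
  then show ?thesis using that[OF v] v vdeg_attach[OF finite_T[OF assms]] by simp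
qed

lemma vdeg_new_vertex:
  assumes "n \<ge> 1" "\<omega> \<in> space M"
  shows "vdeg (T n \<omega>) (Suc n) = 0"
proof -
  have "{e \<in> T n \<omega>. Suc n \<in> e} = {}" using T_vertices[OF assms] by fastforce
  then show ?thesis by (simp only: vdeg_def card.empty)
qed

lemma vdeg_newest:
  assumes "n \<ge> 1" "\<omega> \<in> space M"
  shows "vdeg (T n \<omega>) n = 1"
proof (cases "n = 1")
  case True
  have "{e. e = {0, Suc 0} \<and> Suc 0 \<in> e} = {{0, Suc 0}}" by auto
  then show ?thesis using True T_1[OF assms(2)] by (simp add: vdeg_def)
next
  case False
  then obtain m where m: "n = Suc m" "m \<ge> 1" using assms(1) by (cases n) auto
  obtain v where "\<And>u. vdeg (T (Suc m) \<omega>) u = vdeg (T m \<omega>) u + (if u = v \<or> u = Suc m then 1 else 0)"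
    using vdeg_T_Suc[OF m(2) assms(2)] by metis
  then show ?thesis using vdeg_new_vertex[OF m(2) assms(2)] m by simp
qed

lemma sum_vdeg:
  assumes "n \<ge> 1" "\<omega> \<in> space M"
  shows "(\<Sum>j\<le>n. vdeg (T n \<omega>) j) = 2 * n"
  using assms(1)
proof (induction n rule: nat_induct_at_least)
  case base
  have "{e. e = {0, Suc 0} \<and> Suc 0 \<in> e} = {{0, Suc 0}}" "{e. e = {0, Suc 0} \<and> 0 \<in> e} = {{0, Suc 0}}"
    by auto
  then show ?case using T_1[OF assms(2)] by (simp add: vdeg_def)
next
  case (Suc n)
  obtain v where v: "v \<le> n"
    "\<And>u. vdeg (T (Suc n) \<omega>) u = vdeg (T n \<omega>) u + (if u = v \<or> u = Suc n then 1 else 0)"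
    using vdeg_T_Suc[OF Suc.hyps assms(2)] by metis
  have "(\<Sum>j\<le>n. vdeg (T (Suc n) \<omega>) j) = (\<Sum>j\<le>n. vdeg (T n \<omega>) j + (if j = v then 1 else 0))"
    by (intro sum.cong) (auto simp: v(2))
  also have "\<dots> = 2 * n + 1" using v(1) by (simp add: sum.distrib Suc.IH)
  finally show ?case using vdeg_newest[of "Suc n", OF _ assms(2)] by simp
qed

text \<open>The normalising constant in the attachment probabilities is deterministic; this is what makes the
  recursion at a single vertex linear.\<close>

lemma sum_theta:
  assumes "\<omega> \<in> space M"
  shows "(\<Sum>j\<le>n. theta \<delta> (\<lambda>m. T m \<omega>) j n) = total_weight \<delta> n"
proof (induction n)
  case 0
  have "{e. e = {0, Suc 0} \<and> 0 \<in> e} = {{0, Suc 0}}" by auto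
  then show ?case using T_0[OF assms] T_1[OF assms]
    by (simp add: theta_def vdeg_def total_weight_def)
next
  case (Suc n)
  have "(\<Sum>j\<le>Suc n. theta \<delta> (\<lambda>m. T m \<omega>) j (Suc n)) =
      (\<Sum>j\<le>Suc n. theta \<delta> (\<lambda>m. T m \<omega>) j n) + (\<Sum>j\<le>Suc n. real (vdeg (T (Suc n) \<omega>) j) + \<delta>)"
    by (simp add: theta_Suc sum.distrib)
  also have "(\<Sum>j\<le>Suc n. theta \<delta> (\<lambda>m. T m \<omega>) j n) = total_weight \<delta> n"
    by (simp add: Suc.IH) (simp add: theta_def)
  also have "(\<Sum>j\<le>Suc n. real (vdeg (T (Suc n) \<omega>) j) + \<delta>) =
      real (\<Sum>j\<le>Suc n. vdeg (T (Suc n) \<omega>) j) + (real n + 2) * \<delta>"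
    by (simp only: sum.distrib of_nat_sum) simp
  also have "\<dots> = 2 * (real n + 1) + (real n + 2) * \<delta>"
    by (subst sum_vdeg) (use assms in auto)
  finally show ?case by (simp add: total_weight_def field_simps)
qed

section \<open>Functions of the history\<close>

text \<open>Measurability with respect to the history up to time \<open>n\<close>. As the trees are discrete, it suffices
  to ask for a function of \<open>T\<^sub>0, \<dots>, T\<^sub>n\<close>.\<close>

definition determined :: "nat \<Rightarrow> ('a \<Rightarrow> 'b) \<Rightarrow> bool" where
  "determined n G \<longleftrightarrow>
    (\<forall>\<omega>\<in>space M. \<forall>\<omega>'\<in>space M. (\<forall>m\<le>n. T m \<omega> = T m \<omega>') \<longrightarrow> G \<omega> = G \<omega>')"

lemma determined_mono: "determined m G \<Longrightarrow> m \<le> n \<Longrightarrow> determined n G"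
  unfolding determined_def by (meson order_trans)

lemma determined_T: "m \<le> n \<Longrightarrow> determined n (T m)"
  by (simp add: determined_def)

lemma determined_const: "determined n (\<lambda>_. c)"
  by (simp add: determined_def)

lemma determined_apply: "determined n F \<Longrightarrow> determined n (\<lambda>\<omega>. h (F \<omega>))"
  unfolding determined_def by metis

lemma determined_apply2: "determined n F \<Longrightarrow> determined n G \<Longrightarrow> determined n (\<lambda>\<omega>. h (F \<omega>) (G \<omega>))"
  unfolding determined_def by metis

definition cylinder :: "nat \<Rightarrow> 'a \<Rightarrow> 'a set" where
  "cylinder n r = {\<omega> \<in> space M. \<forall>m\<le>n. T m \<omega> = T m r}"

lemma cylinder_measurable [measurable]: "cylinder n r \<in> sets M"
proof -
  have "cylinder n r = (\<Inter>m\<in>{..n}. T m -` {T m r} \<inter> space M)"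
    by (auto simp: cylinder_def)
  also have "\<dots> \<in> sets M"
    by (intro sets.finite_INT) (auto intro!: measurable_sets[OF T_measurable])
  finally show ?thesis .
qed

text \<open>Only finitely many histories are possible, so a function of the history is a finite linear
  combination of indicators of cylinders. One set \<open>R\<close> of representatives serves all such functions.
  Such functions are thereby bounded and integrable, and conditional expectations become finite
  sums.\<close>

lemma finite_histories:
  obtains R where "finite R" "R \<subseteq> space M"
    "\<And>G \<omega>. determined n G \<Longrightarrow> \<omega> \<in> space M \<Longrightarrow>
      G \<omega> = (\<Sum>r\<in>R. G r * indicator (cylinder n r) \<omega> :: real)"
proof -
  define h where "h \<omega> = map (\<lambda>m. T m \<omega>) [0..<Suc n]" for \<omega>
  have h_eq: "h \<omega> = h \<omega>' \<longleftrightarrow> (\<forall>m\<le>n. T m \<omega> = T m \<omega>')" for \<omega> \<omega>'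
    by (auto simp: h_def simp del: upt_Suc)
  have bounded: "T m \<omega> \<subseteq> Pow {..Suc n}" if "m \<le> n" "\<omega> \<in> space M" for m \<omega>
  proof (cases "m = 0")
    case True
    then show ?thesis using T_0[OF that(2)] T_1[OF that(2)] by auto
  next
    case False
    then have "T m \<omega> \<subseteq> Pow {..m}" using T_edges that by simp
    also have "\<dots> \<subseteq> Pow {..Suc n}" using that by auto
    finally show ?thesis .
  qed
  have "set (h \<omega>) \<subseteq> Pow (Pow {..Suc n})" if "\<omega> \<in> space M" for \<omega>
    unfolding h_def set_map using that
    by (intro image_subsetI PowI bounded) auto
  then have "h ` space M \<subseteq> {xs. set xs \<subseteq> Pow (Pow {..Suc n}) \<and> length xs = Suc n}"
    by (intro image_subsetI CollectI conjI) (auto simp: h_def simp del: upt_Suc)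
  then have fin: "finite (h ` space M)"
    by (rule finite_subset) (intro finite_lists_length_eq, simp)
  \<comment> \<open>One representative path for each history.\<close>
  define R where "R = inv_into (space M) h ` h ` space M"
  show thesis
  proof
    show "finite R" using fin by (simp add: R_def)
    show R: "R \<subseteq> space M" by (auto simp: R_def inv_into_into)
    fix G :: "'a \<Rightarrow> real" and \<omega>
    assume G: "determined n G" and \<omega>: "\<omega> \<in> space M"
    define r where "r = inv_into (space M) h (h \<omega>)"
    have r: "r \<in> R" "h r = h \<omega>" using \<omega> by (auto simp: r_def R_def f_inv_into_f)
    have uniq: "s = r" if "s \<in> R" "h s = h \<omega>" for s
      using that R by (auto simp: R_def r_def f_inv_into_f)
    have ind: "indicator (cylinder n s) \<omega> = (if s = r then 1 else 0 :: real)" if "s \<in> R" for s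
    proof -
      have "\<omega> \<in> cylinder n s \<longleftrightarrow> h \<omega> = h s"
        unfolding h_eq cylinder_def using \<omega> by simp
      then have "\<omega> \<in> cylinder n s \<longleftrightarrow> s = r" using uniq[OF that] r(2) by metis
      then show ?thesis by (auto simp: indicator_def)
    qed
    have "(\<Sum>s\<in>R. G s * indicator (cylinder n s) \<omega>) = (\<Sum>s\<in>R. if s = r then G s else 0)"
      by (intro sum.cong) (auto simp: ind)
    also have "\<dots> = G r" using r \<open>finite R\<close> by (simp add: sum.delta)
    also have "\<dots> = G \<omega>"
    proof -
      have "\<forall>m\<le>n. T m r = T m \<omega>" using r(2) unfolding h_eq .
      then show ?thesis
        using G r(1) R \<omega> unfolding determined_def by blast
    qed
    finally show "G \<omega> = (\<Sum>r\<in>R. G r * indicator (cylinder n r) \<omega>)" by simp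
  qed
qed

lemma integrable_determined:
  fixes G :: "'a \<Rightarrow> real"
  assumes "determined n G"
  shows "integrable M G"
proof -
  obtain R where "finite R" "\<And>\<omega>. \<omega> \<in> space M \<Longrightarrow> G \<omega> = (\<Sum>r\<in>R. G r * indicator (cylinder n r) \<omega>)"
    using finite_histories[of n] assms by metis
  moreover have "integrable M (\<lambda>\<omega>. \<Sum>r\<in>R. G r * indicator (cylinder n r) \<omega>)"
    by (intro Bochner_Integration.integrable_sum integrable_mult_right integrable_real_indicator)
       (auto simp: emeasure_eq_measure)
  ultimately show ?thesis by (subst Bochner_Integration.integrable_cong[OF refl]) auto
qed

end

section \<open>The recursion at an observed vertex\<close>

locale observed_vertex = self_reinforced_pa_trees +
  fixes i :: nat
  assumes i_ge_1: "i \<ge> 1" and delta_gt: "\<delta> > -1"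
begin

definition X :: "nat \<Rightarrow> 'a \<Rightarrow> real" where "X n \<omega> = real (vdeg (T n \<omega>) i) + \<delta>"

definition Theta :: "nat \<Rightarrow> 'a \<Rightarrow> real" where "Theta n \<omega> = theta \<delta> (\<lambda>m. T m \<omega>) i n"

definition hit :: "nat \<Rightarrow> 'a set" where
  "hit n = {\<omega> \<in> space M. T (Suc n) \<omega> = attach (T n \<omega>) (Suc n) i}"

text \<open>The centred increment of the degree; it has conditional mean zero by \<open>expectation_hit\<close>.\<close>

definition noise :: "nat \<Rightarrow> 'a \<Rightarrow> real" where
  "noise n \<omega> = indicator (hit n) \<omega> - Theta n \<omega> / total_weight \<delta> n"

text \<open>The tree \<open>T\<^sub>n\<^sub>+\<^sub>1\<close> determines the vertex that was chosen, because the new edge was not in \<open>T\<^sub>n\<close>. So the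
  event in the conditional law is exactly the event that the degree of \<open>v\<^sub>i\<close> grows.\<close>

lemma X_Suc:
  assumes "n \<ge> i" "\<omega> \<in> space M"
  shows "X (Suc n) \<omega> = X n \<omega> + Theta n \<omega> / total_weight \<delta> n + noise n \<omega>"
proof -
  have n: "n \<ge> 1" using assms i_ge_1 by simp
  obtain v where v: "v \<le> n" "T (Suc n) \<omega> = attach (T n \<omega>) (Suc n) v"
    "\<And>u. vdeg (T (Suc n) \<omega>) u = vdeg (T n \<omega>) u + (if u = v \<or> u = Suc n then 1 else 0)"
    using vdeg_T_Suc[OF n assms(2)] by metis
  have "{Suc n, v} \<notin> T n \<omega>" using T_vertices[OF n assms(2)] by fastforce
  then have "i = v" if "attach (T n \<omega>) (Suc n) v = attach (T n \<omega>) (Suc n) i"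
  proof -
    have "{Suc n, v} \<in> insert {Suc n, i} (T n \<omega>)" using that unfolding attach_def by blast
    then have "{Suc n, v} = {Suc n, i}" using \<open>{Suc n, v} \<notin> T n \<omega>\<close> by simp
    then show ?thesis using v(1) by (auto simp: doubleton_eq_iff)
  qed
  then have "\<omega> \<in> hit n \<longleftrightarrow> i = v" using v(2) assms(2) by (auto simp: hit_def)
  then show ?thesis using v(3)[of i] assms(1) by (auto simp: X_def noise_def)
qed

lemma Theta_Suc: "n \<ge> i \<Longrightarrow> Theta (Suc n) \<omega> = Theta n \<omega> + X (Suc n) \<omega>"
  by (simp add: Theta_def X_def theta_Suc)

lemma X_mono_pos:
  assumes "n \<ge> i" "\<omega> \<in> space M"
  shows "X n \<omega> \<le> X (Suc n) \<omega>" "0 < X n \<omega>"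
proof -
  have step: "X m \<omega> \<le> X (Suc m) \<omega>" if "m \<ge> i" for m
  proof -
    have m: "m \<ge> 1" using that i_ge_1 by simp
    obtain v where "vdeg (T (Suc m) \<omega>) i = vdeg (T m \<omega>) i + (if i = v \<or> i = Suc m then 1 else 0)"
      using vdeg_T_Suc[OF m assms(2)] by metis
    then show ?thesis by (simp add: X_def)
  qed
  show "X n \<omega> \<le> X (Suc n) \<omega>" using step assms by simp
  show "0 < X n \<omega>" using assms(1)
  proof (induction n rule: nat_induct_at_least)
    case base
    show ?case using vdeg_newest[OF i_ge_1 assms(2)] delta_gt by (simp add: X_def)
  next
    case (Suc m)
    then show ?case using step[of m] by simp
  qed
qed

lemma Theta_pos:
  assumes "n \<ge> i" "\<omega> \<in> space M"
  shows "0 < Theta n \<omega>"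
  using assms(1)
proof (induction n rule: nat_induct_at_least)
  case base
  show ?case using X_mono_pos(2)[of i \<omega>] assms by (simp add: Theta_def theta_def X_def)
next
  case (Suc m)
  then show ?case using X_mono_pos(2)[of "Suc m" \<omega>] assms by (simp add: Theta_Suc)
qed

lemma determined_X: "determined n (X n)"
  by (simp add: determined_def X_def)

lemma determined_Theta: "determined n (Theta n)"
  by (auto simp: determined_def Theta_def theta_def intro!: sum.cong)

lemma determined_hit: "determined (Suc n) (indicator (hit n) :: 'a \<Rightarrow> real)"
  by (auto simp: determined_def hit_def indicator_def)

lemma determined_noise: "determined (Suc n) (noise n)"
proof -
  have "determined (Suc n) (\<lambda>\<omega>. Theta n \<omega> / total_weight \<delta> n)"
    by (rule determined_apply[where F = "Theta n"], rule determined_mono[OF determined_Theta]) simp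
  then show ?thesis unfolding noise_def by (rule determined_apply2[OF determined_hit])
qed

text \<open>The conditional law of the attachment in integrated form: against a function of the history, the
  indicator of an attachment to \<open>v\<^sub>i\<close> may be replaced by its conditional probability. Both sides are
  sums over histories, and histories of probability zero contribute nothing.\<close>

lemma expectation_hit:
  assumes "n \<ge> i" "determined n G"
  shows "(\<integral>\<omega>. G \<omega> * indicator (hit n) \<omega> \<partial>M) = (\<integral>\<omega>. G \<omega> * (Theta n \<omega> / total_weight \<delta> n) \<partial>M)"
proof -
  let ?p = "\<lambda>\<omega>. Theta n \<omega> / total_weight \<delta> n"
  have n: "n \<ge> 1" using assms i_ge_1 by simp
  obtain R where R: "finite R" "R \<subseteq> space M"
    and expand: "\<And>G \<omega>. determined n G \<Longrightarrow> \<omega> \<in> space M \<Longrightarrow>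
      G \<omega> = (\<Sum>r\<in>R. G r * indicator (cylinder n r) \<omega> :: real)"
    using finite_histories[of n] by metis
  have "(indicator (hit n) :: 'a \<Rightarrow> real) \<in> borel_measurable M"
    using integrable_determined[OF determined_hit] by (rule borel_measurable_integrable)
  moreover have hit_sub: "hit n \<subseteq> space M" by (auto simp: hit_def)
  ultimately have hit [measurable]: "hit n \<in> sets M"
    by (metis borel_measurable_indicator_iff inf.absorb2 inf_commute)
  have prob_hit: "measure M (cylinder n r \<inter> hit n) = ?p r * measure M (cylinder n r)" if "r \<in> R" for r
  proof (cases "measure M (cylinder n r) = 0")
    case True
    have "measure M (cylinder n r \<inter> hit n) \<le> measure M (cylinder n r)"
      by (intro finite_measure_mono) auto
    then show ?thesis using True measure_nonneg[of M "cylinder n r \<inter> hit n"] by simp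
  next
    case False
    then have "0 < \<P>(\<omega> in M. \<forall>m\<le>n. T m \<omega> = T m r)"
      using measure_nonneg[of M "cylinder n r"] by (simp add: cylinder_def less_le)
    from cond_prob_T_Suc[OF n assms(1) this]
    have "measure M (cylinder n r \<inter> hit n) / measure M (cylinder n r) = ?p r"
      using R(2) that sum_theta[of r n]
      by (auto simp: cond_prob_def cylinder_def hit_def Theta_def Int_def conj_commute conj_left_commute)
    then show ?thesis using False by (simp add: field_simps)
  qed
  have "(\<integral>\<omega>. G \<omega> * indicator (hit n) \<omega> \<partial>M) =
      (\<integral>\<omega>. (\<Sum>r\<in>R. G r * indicator (cylinder n r \<inter> hit n) \<omega>) \<partial>M)"
    by (intro Bochner_Integration.integral_cong refl, subst expand[OF assms(2)])
       (auto simp: sum_distrib_right indicator_inter_arith mult.assoc)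
  also have "\<dots> = (\<Sum>r\<in>R. G r * measure M (cylinder n r \<inter> hit n))"
    by (subst Bochner_Integration.integral_sum) (auto simp: emeasure_eq_measure)
  also have "\<dots> = (\<Sum>r\<in>R. G r * ?p r * measure M (cylinder n r))"
    by (intro sum.cong) (auto simp: prob_hit)
  also have "\<dots> = (\<integral>\<omega>. (\<Sum>r\<in>R. G r * ?p r * indicator (cylinder n r) \<omega>) \<partial>M)"
    by (subst Bochner_Integration.integral_sum) (auto simp: emeasure_eq_measure)
  also have "\<dots> = (\<integral>\<omega>. G \<omega> * ?p \<omega> \<partial>M)"
    by (intro Bochner_Integration.integral_cong refl expand[symmetric]
          determined_apply2[OF assms(2) determined_Theta, of "\<lambda>x y. x * (y / total_weight \<delta> n)"])
  finally show ?thesis .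
qed

definition alpha :: real where "alpha = 1 / phi \<delta>"

lemma alpha: "0 < alpha" "alpha < 1" "alpha * (1 + alpha) * (1 + \<delta> / 2) = 1"
  unfolding alpha_def using inverse_phi[OF delta_gt] by blast+

text \<open>The sequences \<open>a\<close> and \<open>b\<close> solve asymptotically the adjoint recursion
  \<open>a\<^sub>n = a\<^sub>n\<^sub>+\<^sub>1 + b\<^sub>n\<^sub>+\<^sub>1\<close>, \<open>b\<^sub>n = b\<^sub>n\<^sub>+\<^sub>1 + a\<^sub>n / S\<^sub>n\<close>, which would make \<open>a X + b \<Theta>\<close> a martingale.\<close>

definition a :: "nat \<Rightarrow> real" where "a n = real n powr (- alpha)"

definition b :: "nat \<Rightarrow> real" where "b n = alpha * real n powr (- alpha - 1)"

lemma a_pos: "n \<ge> 1 \<Longrightarrow> 0 < a n" by (simp add: a_def)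

lemma a_decreasing: "n \<ge> 1 \<Longrightarrow> a (Suc n) \<le> a n"
  unfolding a_def using alpha(1) by (intro powr_mono2') auto

lemma a_tendsto_0: "a \<longlonglongrightarrow> 0"
  unfolding a_def using alpha(1) by real_asymp

lemma b_nonneg: "0 \<le> b n" using alpha(1) by (simp add: b_def)

definition L :: "nat \<Rightarrow> 'a \<Rightarrow> real" where "L n \<omega> = a n * X n \<omega> + b n * Theta n \<omega>"

definition drift :: "nat \<Rightarrow> 'a \<Rightarrow> real" where
  "drift n \<omega> = (a (Suc n) + b (Suc n) - a n) * X n \<omega> +
    ((a (Suc n) + b (Suc n)) / total_weight \<delta> n + b (Suc n) - b n) * Theta n \<omega>"

lemma L_Suc:
  assumes "n \<ge> i" "\<omega> \<in> space M"
  shows "L (Suc n) \<omega> = L n \<omega> + drift n \<omega> + (a (Suc n) + b (Suc n)) * noise n \<omega>"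
  unfolding L_def drift_def Theta_Suc[OF assms(1)] X_Suc[OF assms] by (simp add: algebra_simps add_divide_distrib)

lemma L_pos: "n \<ge> i \<Longrightarrow> \<omega> \<in> space M \<Longrightarrow> 0 < L n \<omega>"
  unfolding L_def using i_ge_1 by (intro add_pos_nonneg mult_pos_pos mult_nonneg_nonneg a_pos b_nonneg
    X_mono_pos less_imp_le[OF Theta_pos]) auto

lemma determined_L: "determined n (L n)"
  unfolding L_def by (rule determined_apply2[OF determined_X determined_Theta, where h = "\<lambda>x y. a n * x + b n * y"])

lemma determined_drift: "determined n (drift n)"
  unfolding drift_def by (rule determined_apply2[OF determined_X determined_Theta])

text \<open>The bounds on which all moment estimates rest. Drift and conditional variance are both compared
  with \<open>a n - a (Suc n)\<close>, whose sums telescope; the bound \<open>1 / 2\<close> allows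
  products of factors \<open>1 - C * (a n - a (Suc n))\<close> to be compared with exponentials.\<close>

definition drift_control :: "real \<Rightarrow> nat \<Rightarrow> bool" where
  "drift_control C N \<longleftrightarrow> C > 0 \<and> N \<ge> i \<and> (\<forall>n\<ge>N. C * (a n - a (Suc n)) \<le> 1 / 2 \<and> (\<forall>\<omega>\<in>space M.
      \<bar>drift n \<omega>\<bar> \<le> C * (a n - a (Suc n)) * L n \<omega> \<and>
      (a (Suc n) + b (Suc n))\<^sup>2 * (Theta n \<omega> / total_weight \<delta> n) \<le> C * (a n - a (Suc n)) * L n \<omega>))"

lemma drift_control_exists: obtains C N where "drift_control C N"
proof -
  let ?d = "\<lambda>n. a n - a (Suc n)"
  have d: "0 \<le> ?d n" if "n \<ge> 1" for n using a_decreasing[OF that] by simp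
  have W: "total_weight \<delta> n > 0" for n by (rule total_weight_pos[OF delta_gt])
  have "(\<lambda>n. a (Suc n) + b (Suc n) - a n) \<in> O(\<lambda>n. ?d n * a n)"
    unfolding a_def b_def by (rule drift_coefficient_X[OF alpha(1,2)])
  then obtain C1 where C1: "C1 > 0"
    "\<forall>\<^sub>F n in sequentially. \<bar>a (Suc n) + b (Suc n) - a n\<bar> \<le> C1 * (?d n * a n)"
    by (rule bigo_eventually_le) (intro mult_nonneg_nonneg d less_imp_le[OF a_pos])
  have "(\<lambda>n. (a (Suc n) + b (Suc n)) / total_weight \<delta> n + b (Suc n) - b n) \<in> O(\<lambda>n. ?d n * b n)"
    unfolding a_def b_def by (rule drift_coefficient_Theta[OF alpha])
  then obtain C2 where C2: "C2 > 0" "\<forall>\<^sub>F n in sequentially.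
      \<bar>(a (Suc n) + b (Suc n)) / total_weight \<delta> n + b (Suc n) - b n\<bar> \<le> C2 * (?d n * b n)"
    by (rule bigo_eventually_le) (intro mult_nonneg_nonneg d b_nonneg)
  have "(\<lambda>n. (a (Suc n) + b (Suc n))\<^sup>2 / total_weight \<delta> n) \<in> O(\<lambda>n. ?d n * b n)"
    unfolding a_def b_def by (rule noise_coefficient[OF alpha(1,2) delta_gt])
  then obtain C3 where C3: "C3 > 0" "\<forall>\<^sub>F n in sequentially.
      \<bar>(a (Suc n) + b (Suc n))\<^sup>2 / total_weight \<delta> n\<bar> \<le> C3 * (?d n * b n)"
    by (rule bigo_eventually_le) (intro mult_nonneg_nonneg d b_nonneg)
  define C where "C = C1 + C2 + C3"
  have C: "C > 0" "C1 \<le> C" "C2 \<le> C" "C3 \<le> C" using C1(1) C2(1) C3(1) by (auto simp: C_def)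
  have "(\<lambda>n. C * ?d n) \<longlonglongrightarrow> C * (0 - 0)"
    by (intro tendsto_intros a_tendsto_0 LIMSEQ_Suc)
  then have "\<forall>\<^sub>F n in sequentially. C * ?d n < 1 / 2" by (intro order_tendstoD) auto
  with C1(2) C2(2) C3(2) eventually_ge_at_top[of i]
  have "\<forall>\<^sub>F n in sequentially. C * ?d n \<le> 1 / 2 \<and> (\<forall>\<omega>\<in>space M.
      \<bar>drift n \<omega>\<bar> \<le> C * ?d n * L n \<omega> \<and>
      (a (Suc n) + b (Suc n))\<^sup>2 * (Theta n \<omega> / total_weight \<delta> n) \<le> C * ?d n * L n \<omega>)"
  proof eventually_elim
    case (elim n)
    let ?r = "a (Suc n) + b (Suc n)"
    have n1: "n \<ge> 1" using elim(4) i_ge_1 by simp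
    have da: "0 \<le> ?d n * a n" "0 \<le> ?d n * b n"
      using d[OF n1] a_pos[OF n1] b_nonneg by (auto intro: mult_nonneg_nonneg)
    have e1: "\<bar>?r - a n\<bar> \<le> C * (?d n * a n)"
      using elim(1) mult_right_mono[OF C(2) da(1)] by linarith
    have e2: "\<bar>?r / total_weight \<delta> n + b (Suc n) - b n\<bar> \<le> C * (?d n * b n)"
      using elim(2) mult_right_mono[OF C(3) da(2)] by linarith
    have e3: "?r\<^sup>2 / total_weight \<delta> n \<le> C * (?d n * b n)"
      using elim(3) mult_right_mono[OF C(4) da(2)] by linarith
    have "\<bar>drift n \<omega>\<bar> \<le> C * ?d n * L n \<omega> \<and> ?r\<^sup>2 * (Theta n \<omega> / total_weight \<delta> n) \<le> C * ?d n * L n \<omega>"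
      if "\<omega> \<in> space M" for \<omega>
    proof
      have X: "0 \<le> X n \<omega>" and Theta: "0 \<le> Theta n \<omega>"
        using X_mono_pos(2) Theta_pos elim(4) that by (auto intro: less_imp_le)
      have "\<bar>drift n \<omega>\<bar> \<le> \<bar>?r - a n\<bar> * X n \<omega> + \<bar>?r / total_weight \<delta> n + b (Suc n) - b n\<bar> * Theta n \<omega>"
        unfolding drift_def using X Theta by (intro order_trans[OF abs_triangle_ineq]) (simp add: abs_mult)
      also have "\<dots> \<le> C * (?d n * a n) * X n \<omega> + C * (?d n * b n) * Theta n \<omega>"
        by (intro add_mono mult_right_mono e1 e2 X Theta)
      also have "\<dots> = C * ?d n * L n \<omega>" by (simp add: L_def algebra_simps)
      finally show "\<bar>drift n \<omega>\<bar> \<le> C * ?d n * L n \<omega>" .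
      have "?r\<^sup>2 * (Theta n \<omega> / total_weight \<delta> n) = ?r\<^sup>2 / total_weight \<delta> n * Theta n \<omega>" by simp
      also have "\<dots> \<le> C * (?d n * b n) * Theta n \<omega>" by (intro mult_right_mono e3 Theta)
      also have "\<dots> \<le> C * (?d n * a n) * X n \<omega> + C * (?d n * b n) * Theta n \<omega>"
        using C(1) da(1) X by simp
      also have "\<dots> = C * ?d n * L n \<omega>" by (simp add: L_def algebra_simps)
      finally show "?r\<^sup>2 * (Theta n \<omega> / total_weight \<delta> n) \<le> C * ?d n * L n \<omega>" .
    qed
    then show ?case using elim(5) by auto
  qed
  then obtain N0 where "\<And>n. n \<ge> N0 \<Longrightarrow> C * ?d n \<le> 1 / 2 \<and> (\<forall>\<omega>\<in>space M.
      \<bar>drift n \<omega>\<bar> \<le> C * ?d n * L n \<omega> \<and>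
      (a (Suc n) + b (Suc n))\<^sup>2 * (Theta n \<omega> / total_weight \<delta> n) \<le> C * ?d n * L n \<omega>)"
    unfolding eventually_sequentially by blast
  then have "drift_control C (max i N0)" unfolding drift_control_def using C(1) by simp
  then show ?thesis by (rule that)
qed

section \<open>Moment bounds\<close>

lemma expectation_mult_noise:
  assumes "n \<ge> i" "determined n G"
  shows "(\<integral>\<omega>. G \<omega> * noise n \<omega> \<partial>M) = 0"
proof -
  have G: "determined (Suc n) G" using determined_mono[OF assms(2)] by simp
  have 1: "integrable M (\<lambda>\<omega>. G \<omega> * indicator (hit n) \<omega>)"
    by (rule integrable_determined[OF determined_apply2[OF G determined_hit]])
  have 2: "integrable M (\<lambda>\<omega>. G \<omega> * (Theta n \<omega> / total_weight \<delta> n))"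
    by (rule integrable_determined[OF determined_apply2[OF assms(2) determined_Theta]])
  have "(\<integral>\<omega>. G \<omega> * noise n \<omega> \<partial>M) =
      (\<integral>\<omega>. G \<omega> * indicator (hit n) \<omega> - G \<omega> * (Theta n \<omega> / total_weight \<delta> n) \<partial>M)"
    by (simp add: noise_def right_diff_distrib)
  then show ?thesis using 1 2 expectation_hit[OF assms] by simp
qed

text \<open>The conditional variance of an indicator of conditional probability \<open>p\<close> is \<open>p - p\<^sup>2\<close>, and the
  square is dropped.\<close>

lemma expectation_noise_square:
  assumes "n \<ge> i"
  shows "(\<integral>\<omega>. (noise n \<omega>)\<^sup>2 \<partial>M) \<le> (\<integral>\<omega>. Theta n \<omega> / total_weight \<delta> n \<partial>M)"
proof -
  define p where "p \<omega> = Theta n \<omega> / total_weight \<delta> n" for \<omega>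
  define I :: "'a \<Rightarrow> real" where "I = indicator (hit n)"
  have I: "determined (Suc n) I" unfolding I_def by (rule determined_hit)
  have p: "determined n p" unfolding p_def by (rule determined_apply[OF determined_Theta])
  have p': "determined (Suc n) p" using determined_mono[OF p] by simp
  have int: "integrable M I" "integrable M p" "integrable M (\<lambda>\<omega>. (p \<omega>)\<^sup>2)"
    "integrable M (\<lambda>\<omega>. p \<omega> * I \<omega>)"
    by (rule integrable_determined, (rule I p determined_apply[OF p] determined_apply2[OF p' I]))+
  have hit: "(\<integral>\<omega>. G \<omega> * I \<omega> \<partial>M) = (\<integral>\<omega>. G \<omega> * p \<omega> \<partial>M)" if "determined n G" for G
    unfolding I_def p_def by (rule expectation_hit[OF assms that])
  have "(\<integral>\<omega>. (noise n \<omega>)\<^sup>2 \<partial>M) = (\<integral>\<omega>. I \<omega> - 2 * (p \<omega> * I \<omega>) + (p \<omega>)\<^sup>2 \<partial>M)"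
  proof (intro Bochner_Integration.integral_cong refl)
    fix \<omega>
    have "I \<omega> * I \<omega> = I \<omega>" by (simp add: I_def indicator_def)
    then show "(noise n \<omega>)\<^sup>2 = I \<omega> - 2 * (p \<omega> * I \<omega>) + (p \<omega>)\<^sup>2"
      unfolding noise_def I_def[symmetric] p_def[symmetric] power2_eq_square by (simp add: algebra_simps)
  qed
  also have "\<dots> = (\<integral>\<omega>. I \<omega> \<partial>M) - 2 * (\<integral>\<omega>. p \<omega> * I \<omega> \<partial>M) + (\<integral>\<omega>. (p \<omega>)\<^sup>2 \<partial>M)"
    using int by simp
  also have "\<dots> = (\<integral>\<omega>. p \<omega> \<partial>M) - (\<integral>\<omega>. (p \<omega>)\<^sup>2 \<partial>M)"
    using hit[OF determined_const[of n 1]] hit[OF p] by (simp add: power2_eq_square)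
  also have "\<dots> \<le> (\<integral>\<omega>. p \<omega> \<partial>M)" by simp
  finally show ?thesis unfolding p_def .
qed

text \<open>The noise is orthogonal to the past, so it adds only its own variance to a second moment.\<close>

lemma expectation_square_step:
  assumes ctrl: "drift_control C N" and n: "n \<ge> N" and G: "determined n G"
  shows "(\<integral>\<omega>. (G \<omega> + (a (Suc n) + b (Suc n)) * noise n \<omega>)\<^sup>2 \<partial>M) \<le>
    (\<integral>\<omega>. (G \<omega>)\<^sup>2 \<partial>M) + C * (a n - a (Suc n)) * (\<integral>\<omega>. L n \<omega> \<partial>M)"
proof -
  let ?r = "a (Suc n) + b (Suc n)"
  have ni: "n \<ge> i" using ctrl n by (auto simp: drift_control_def)
  have G': "determined (Suc n) G" using determined_mono[OF G] by simp
  have int: "integrable M (\<lambda>\<omega>. (G \<omega>)\<^sup>2)" "integrable M (\<lambda>\<omega>. (noise n \<omega>)\<^sup>2)" "integrable M (\<lambda>\<omega>. G \<omega> * noise n \<omega>)"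
    by (rule integrable_determined,
        (rule determined_apply[OF G] determined_apply[OF determined_noise]
            determined_apply2[OF G' determined_noise]))+
  have int_p: "integrable M (\<lambda>\<omega>. Theta n \<omega> / total_weight \<delta> n)"
    by (rule integrable_determined[OF determined_apply[OF determined_Theta]])
  have "(\<integral>\<omega>. (G \<omega> + ?r * noise n \<omega>)\<^sup>2 \<partial>M) =
      (\<integral>\<omega>. (G \<omega>)\<^sup>2 + 2 * ?r * (G \<omega> * noise n \<omega>) + ?r\<^sup>2 * (noise n \<omega>)\<^sup>2 \<partial>M)"
    by (intro Bochner_Integration.integral_cong refl) (simp add: power2_eq_square algebra_simps)
  also have "\<dots> = (\<integral>\<omega>. (G \<omega>)\<^sup>2 \<partial>M) + 2 * ?r * (\<integral>\<omega>. G \<omega> * noise n \<omega> \<partial>M) + ?r\<^sup>2 * (\<integral>\<omega>. (noise n \<omega>)\<^sup>2 \<partial>M)"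
    using int by simp
  also have "\<dots> = (\<integral>\<omega>. (G \<omega>)\<^sup>2 \<partial>M) + ?r\<^sup>2 * (\<integral>\<omega>. (noise n \<omega>)\<^sup>2 \<partial>M)"
    by (simp add: expectation_mult_noise[OF ni G])
  also have "\<dots> \<le> (\<integral>\<omega>. (G \<omega>)\<^sup>2 \<partial>M) + ?r\<^sup>2 * (\<integral>\<omega>. Theta n \<omega> / total_weight \<delta> n \<partial>M)"
    by (intro add_left_mono mult_left_mono expectation_noise_square ni) simp
  also have "?r\<^sup>2 * (\<integral>\<omega>. Theta n \<omega> / total_weight \<delta> n \<partial>M) = (\<integral>\<omega>. ?r\<^sup>2 * (Theta n \<omega> / total_weight \<delta> n) \<partial>M)"
    by (rule integral_mult_right_zero[symmetric])
  also have "\<dots> \<le> (\<integral>\<omega>. C * (a n - a (Suc n)) * L n \<omega> \<partial>M)"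
  proof (rule integral_mono)
    show "integrable M (\<lambda>\<omega>. ?r\<^sup>2 * (Theta n \<omega> / total_weight \<delta> n))" by (rule integrable_mult_right[OF int_p])
    show "integrable M (\<lambda>\<omega>. C * (a n - a (Suc n)) * L n \<omega>)"
      by (rule integrable_mult_right[OF integrable_determined[OF determined_L]])
    show "?r\<^sup>2 * (Theta n \<omega> / total_weight \<delta> n) \<le> C * (a n - a (Suc n)) * L n \<omega>" if "\<omega> \<in> space M" for \<omega>
      using ctrl n that unfolding drift_control_def by blast
  qed
  also have "\<dots> = C * (a n - a (Suc n)) * (\<integral>\<omega>. L n \<omega> \<partial>M)" by (rule integral_mult_right_zero)
  finally show ?thesis by simp
qed

lemma integrable_L: "integrable M (L n)" and integrable_L_square: "integrable M (\<lambda>\<omega>. (L n \<omega>)\<^sup>2)"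
  by (rule integrable_determined, (rule determined_L determined_apply[OF determined_L]))+

lemma expectation_L_le: "(\<integral>\<omega>. L n \<omega> \<partial>M) \<le> 1 + (\<integral>\<omega>. (L n \<omega>)\<^sup>2 \<partial>M)"
proof -
  have "(\<integral>\<omega>. L n \<omega> \<partial>M) \<le> (\<integral>\<omega>. 1 + (L n \<omega>)\<^sup>2 \<partial>M)"
  proof (rule integral_mono[OF integrable_L])
    show "integrable M (\<lambda>\<omega>. 1 + (L n \<omega>)\<^sup>2)" using integrable_L_square by simp
    show "L n \<omega> \<le> 1 + (L n \<omega>)\<^sup>2" for \<omega>
      using zero_le_power2[of "L n \<omega> - 1 / 2"] by (simp add: power2_eq_square algebra_simps)
  qed
  then show ?thesis using integrable_L_square by (simp add: prob_space)
qed

text \<open>One step multiplies \<open>1 + E L\<^sub>n\<^sup>2\<close> by at most \<open>1 + 4 C (a\<^sub>n - a\<^sub>n\<^sub>+\<^sub>1)\<close>, and the product of these factors is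
  bounded by telescoping in the exponent. The summand \<open>1\<close> absorbs the
  first moment that the variance of the noise brings in.\<close>

lemma second_moment_bounded:
  assumes ctrl: "drift_control C N"
  obtains K where "\<And>n. n \<ge> N \<Longrightarrow> 1 + (\<integral>\<omega>. (L n \<omega>)\<^sup>2 \<partial>M) \<le> K"
proof -
  define m where "m n = 1 + (\<integral>\<omega>. (L n \<omega>)\<^sup>2 \<partial>M)" for n
  have m_pos: "m n > 0" for n unfolding m_def by (simp add: add_pos_nonneg)
  have N: "N \<ge> i" "N \<ge> 1" "C > 0" using ctrl i_ge_1 by (auto simp: drift_control_def)
  have growth: "m n \<le> m N * exp (4 * C * (a N - a n))" if "n \<ge> N" for n
    using that
  proof (induction n rule: nat_induct_at_least)
    case base
    show ?case by simp
  next
    case (Suc n)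
    let ?x = "C * (a n - a (Suc n))"
    have x: "0 \<le> ?x" "?x \<le> 1 / 2"
      using ctrl Suc.hyps a_decreasing[of n] N by (auto simp: drift_control_def)
    have G: "determined n (\<lambda>\<omega>. L n \<omega> + drift n \<omega>)" by (rule determined_apply2[OF determined_L determined_drift])
    have "(\<integral>\<omega>. (L (Suc n) \<omega>)\<^sup>2 \<partial>M) = (\<integral>\<omega>. (L n \<omega> + drift n \<omega> + (a (Suc n) + b (Suc n)) * noise n \<omega>)\<^sup>2 \<partial>M)"
      using Suc.hyps N by (intro Bochner_Integration.integral_cong refl) (simp add: L_Suc)
    also have "\<dots> \<le> (\<integral>\<omega>. (L n \<omega> + drift n \<omega>)\<^sup>2 \<partial>M) + ?x * (\<integral>\<omega>. L n \<omega> \<partial>M)"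
      by (rule expectation_square_step[OF ctrl Suc.hyps G])
    also have "\<dots> \<le> (1 + 3 * ?x) * (\<integral>\<omega>. (L n \<omega>)\<^sup>2 \<partial>M) + ?x * m n"
    proof (rule add_mono)
      have "(\<integral>\<omega>. (L n \<omega> + drift n \<omega>)\<^sup>2 \<partial>M) \<le> (\<integral>\<omega>. (1 + 3 * ?x) * (L n \<omega>)\<^sup>2 \<partial>M)"
      proof (rule integral_mono)
        show "integrable M (\<lambda>\<omega>. (L n \<omega> + drift n \<omega>)\<^sup>2)"
          by (rule integrable_determined[OF determined_apply[OF G]])
        show "integrable M (\<lambda>\<omega>. (1 + 3 * ?x) * (L n \<omega>)\<^sup>2)"
          by (rule integrable_mult_right[OF integrable_L_square])
        fix \<omega> assume \<omega>: "\<omega> \<in> space M"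
        have "\<bar>drift n \<omega>\<bar> \<le> ?x * L n \<omega>"
          using ctrl Suc.hyps \<omega> unfolding drift_control_def by blast
        moreover have "0 < L n \<omega>" using L_pos Suc.hyps N \<omega> by simp
        ultimately have "\<bar>L n \<omega> + drift n \<omega>\<bar> \<le> (1 + ?x) * L n \<omega>" unfolding distrib_right mult_1_left by linarith
        then have "(L n \<omega> + drift n \<omega>)\<^sup>2 \<le> ((1 + ?x) * L n \<omega>)\<^sup>2" by (rule abs_le_square_iff[THEN iffD1, OF order_trans]) simp
        also have "\<dots> = (1 + ?x)\<^sup>2 * (L n \<omega>)\<^sup>2" by (rule power_mult_distrib)
        also have "(1 + ?x)\<^sup>2 = 1 + 2 * ?x + ?x * ?x" by (simp add: power2_eq_square algebra_simps)
        also have "(1 + 2 * ?x + ?x * ?x) * (L n \<omega>)\<^sup>2 \<le> (1 + 3 * ?x) * (L n \<omega>)\<^sup>2"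
          using mult_left_mono[OF x(2) x(1)] x by (intro mult_right_mono) auto
        finally show "(L n \<omega> + drift n \<omega>)\<^sup>2 \<le> (1 + 3 * ?x) * (L n \<omega>)\<^sup>2" .
      qed
      then show "(\<integral>\<omega>. (L n \<omega> + drift n \<omega>)\<^sup>2 \<partial>M) \<le> (1 + 3 * ?x) * (\<integral>\<omega>. (L n \<omega>)\<^sup>2 \<partial>M)"
        by (simp only: integral_mult_right_zero)
      show "?x * (\<integral>\<omega>. L n \<omega> \<partial>M) \<le> ?x * m n"
        unfolding m_def by (intro mult_left_mono expectation_L_le x)
    qed
    finally have "m (Suc n) \<le> (1 + 4 * ?x) * m n - 3 * ?x"
      unfolding m_def by (simp add: algebra_simps)
    also have "\<dots> \<le> exp (4 * ?x) * m n"
    proof -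
      have "(1 + 4 * ?x) * m n \<le> exp (4 * ?x) * m n"
        using m_pos by (intro mult_right_mono exp_ge_add_one_self less_imp_le)
      then show ?thesis using x(1) by linarith
    qed
    also have "\<dots> \<le> exp (4 * ?x) * (m N * exp (4 * C * (a N - a n)))"
      by (intro mult_left_mono Suc.IH) simp
    also have "\<dots> = m N * exp (4 * C * (a N - a (Suc n)))"
      by (simp add: mult_exp_exp algebra_simps)
    finally show ?case .
  qed
  have "m n \<le> m N * exp (4 * C * a N)" if "n \<ge> N" for n
  proof -
    have "a n > 0" using that N by (intro a_pos) simp
    then have "exp (4 * C * (a N - a n)) \<le> exp (4 * C * a N)" using N by simp
    then have "m N * exp (4 * C * (a N - a n)) \<le> m N * exp (4 * C * a N)"
      using m_pos[of N] by (intro mult_left_mono) auto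
    then show ?thesis using growth[OF that] by simp
  qed
  then show ?thesis using that unfolding m_def by blast
qed

text \<open>With \<open>n\<close> fixed, each step from \<open>m\<close> to \<open>Suc m\<close> raises \<open>E (L\<^sub>m - L\<^sub>n)\<^sup>2\<close> by at most a constant times
  \<open>a\<^sub>m - a\<^sub>m\<^sub>+\<^sub>1\<close>: the noise by its variance, the drift through its product with \<open>L\<^sub>m - L\<^sub>n\<close>, which is bounded
  by second moments.\<close>

lemma square_increment_bound:
  assumes ctrl: "drift_control C N"
  obtains K where "\<And>m n. N \<le> n \<Longrightarrow> n \<le> m \<Longrightarrow> (\<integral>\<omega>. (L m \<omega> - L n \<omega>)\<^sup>2 \<partial>M) \<le> K * a n"
proof -
  obtain K where K: "\<And>n. n \<ge> N \<Longrightarrow> 1 + (\<integral>\<omega>. (L n \<omega>)\<^sup>2 \<partial>M) \<le> K"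
    using second_moment_bounded[OF ctrl] by blast
  have N: "N \<ge> i" "N \<ge> 1" "C > 0" using ctrl i_ge_1 by (auto simp: drift_control_def)
  have "0 \<le> (\<integral>\<omega>. (L N \<omega>)\<^sup>2 \<partial>M)" by simp
  then have "K > 0" using K[of N] by linarith
  have bound: "(\<integral>\<omega>. (L m \<omega> - L n \<omega>)\<^sup>2 \<partial>M) \<le> 6 * K * C * (a n - a m)" if n: "N \<le> n" and "n \<le> m" for m n
    using \<open>n \<le> m\<close>
  proof (induction m rule: nat_induct_at_least)
    case base
    show ?case by simp
  next
    case (Suc m)
    let ?x = "C * (a m - a (Suc m))"
    have m: "m \<ge> N" "m \<ge> i" using Suc.hyps n N by auto
    have x: "0 \<le> ?x" "?x \<le> 1 / 2"
      using ctrl m a_decreasing[of m] N by (auto simp: drift_control_def)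
    have Ln: "determined m (L n)" using determined_mono[OF determined_L Suc.hyps] .
    have G: "determined m (\<lambda>\<omega>. L m \<omega> - L n \<omega> + drift m \<omega>)"
      by (rule determined_apply2[OF determined_apply2[OF determined_L Ln] determined_drift])
    have int: "integrable M (\<lambda>\<omega>. (L m \<omega> - L n \<omega>)\<^sup>2)"
      by (rule integrable_determined[OF determined_apply2[OF determined_L Ln]])
    have "(\<integral>\<omega>. (L (Suc m) \<omega> - L n \<omega>)\<^sup>2 \<partial>M) =
        (\<integral>\<omega>. (L m \<omega> - L n \<omega> + drift m \<omega> + (a (Suc m) + b (Suc m)) * noise m \<omega>)\<^sup>2 \<partial>M)"
      using m by (intro Bochner_Integration.integral_cong refl) (simp add: L_Suc algebra_simps)
    also have "\<dots> \<le> (\<integral>\<omega>. (L m \<omega> - L n \<omega> + drift m \<omega>)\<^sup>2 \<partial>M) + ?x * (\<integral>\<omega>. L m \<omega> \<partial>M)"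
      by (rule expectation_square_step[OF ctrl m(1) G])
    also have "\<dots> \<le> ((\<integral>\<omega>. (L m \<omega> - L n \<omega>)\<^sup>2 \<partial>M) + ?x * (5 * K)) + ?x * K"
    proof (rule add_mono)
      have "(\<integral>\<omega>. (L m \<omega> - L n \<omega> + drift m \<omega>)\<^sup>2 \<partial>M) \<le>
          (\<integral>\<omega>. (L m \<omega> - L n \<omega>)\<^sup>2 + ?x * (4 * (L m \<omega>)\<^sup>2 + (L n \<omega>)\<^sup>2) \<partial>M)"
      proof (rule integral_mono)
        show "integrable M (\<lambda>\<omega>. (L m \<omega> - L n \<omega> + drift m \<omega>)\<^sup>2)"
          by (rule integrable_determined[OF determined_apply[OF G]])
        show "integrable M (\<lambda>\<omega>. (L m \<omega> - L n \<omega>)\<^sup>2 + ?x * (4 * (L m \<omega>)\<^sup>2 + (L n \<omega>)\<^sup>2))"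
          by (intro Bochner_Integration.integrable_add integrable_mult_right integrable_L_square int)
        fix \<omega> assume \<omega>: "\<omega> \<in> space M"
        define u v w where "u = L m \<omega>" and "v = L n \<omega>" and "w = drift m \<omega>"
        have u: "0 < u" and v: "0 < v"
          using L_pos \<omega> m n N by (auto simp: u_def v_def)
        have w: "\<bar>w\<bar> \<le> ?x * u"
          using ctrl m \<omega> unfolding drift_control_def u_def w_def by blast
        have "(u - v) * w \<le> (u + v) * (?x * u)"
        proof -
          have "(u - v) * w \<le> \<bar>u - v\<bar> * \<bar>w\<bar>" by (simp add: abs_mult[symmetric])
          also have "\<dots> \<le> (u + v) * (?x * u)" using u v by (intro mult_mono w) auto
          finally show ?thesis .
        qed
        then have cross: "2 * ((u - v) * w) \<le> ?x * (2 * u\<^sup>2 + 2 * (u * v))"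
          by (simp add: algebra_simps power2_eq_square)
        have "w\<^sup>2 \<le> (?x * u)\<^sup>2" using w by (rule abs_le_square_iff[THEN iffD1, OF order_trans]) simp
        also have "\<dots> = ?x * (?x * u\<^sup>2)" by (simp add: power2_eq_square)
        also have "\<dots> \<le> ?x * (1 * u\<^sup>2)" using x by (intro mult_left_mono mult_right_mono) auto
        finally have sq: "w\<^sup>2 \<le> ?x * u\<^sup>2" by simp
        have "0 \<le> (u - v)\<^sup>2" by simp
        then have "2 * (u * v) \<le> u\<^sup>2 + v\<^sup>2" by (simp add: power2_diff)
        then have uv: "?x * (2 * (u * v)) \<le> ?x * (u\<^sup>2 + v\<^sup>2)" using x by (intro mult_left_mono) auto
        have "(u - v + w)\<^sup>2 = (u - v)\<^sup>2 + 2 * ((u - v) * w) + w\<^sup>2"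
          by (simp add: power2_eq_square algebra_simps)
        also have "\<dots> \<le> (u - v)\<^sup>2 + ?x * (4 * u\<^sup>2 + v\<^sup>2)"
          using cross sq uv unfolding distrib_left by linarith
        finally show "(L m \<omega> - L n \<omega> + drift m \<omega>)\<^sup>2 \<le>
            (L m \<omega> - L n \<omega>)\<^sup>2 + ?x * (4 * (L m \<omega>)\<^sup>2 + (L n \<omega>)\<^sup>2)"
          unfolding u_def v_def w_def .
      qed
      also have "\<dots> = (\<integral>\<omega>. (L m \<omega> - L n \<omega>)\<^sup>2 \<partial>M) +
          ?x * (4 * (\<integral>\<omega>. (L m \<omega>)\<^sup>2 \<partial>M) + (\<integral>\<omega>. (L n \<omega>)\<^sup>2 \<partial>M))"
        using int integrable_L_square[of m] integrable_L_square[of n] by (simp del: mult_cancel_left)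
      also have "\<dots> \<le> (\<integral>\<omega>. (L m \<omega> - L n \<omega>)\<^sup>2 \<partial>M) + ?x * (5 * K)"
        using K[OF m(1)] K[OF n] x by (intro add_left_mono mult_left_mono) auto
      finally show "(\<integral>\<omega>. (L m \<omega> - L n \<omega> + drift m \<omega>)\<^sup>2 \<partial>M) \<le>
          (\<integral>\<omega>. (L m \<omega> - L n \<omega>)\<^sup>2 \<partial>M) + ?x * (5 * K)" .
      show "?x * (\<integral>\<omega>. L m \<omega> \<partial>M) \<le> ?x * K"
        using expectation_L_le[of m] K[OF m(1)] x by (intro mult_left_mono) auto
    qed
    also have "\<dots> \<le> 6 * K * C * (a n - a m) + ?x * (6 * K)" using Suc.IH by simp
    also have "\<dots> = 6 * K * C * (a n - a (Suc m))" by (simp add: algebra_simps)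
    finally show ?case .
  qed
  have "(\<integral>\<omega>. (L m \<omega> - L n \<omega>)\<^sup>2 \<partial>M) \<le> 6 * K * C * a n" if "N \<le> n" "n \<le> m" for m n
  proof -
    have "0 < a m" using that N by (intro a_pos) simp
    then have "6 * K * C * (a n - a m) \<le> 6 * K * C * a n"
      using \<open>K > 0\<close> N by (intro mult_left_mono) auto
    then show ?thesis using bound[OF that] by linarith
  qed
  then show ?thesis by (rule that)
qed

text \<open>The root of the bound for the second moment, by \<open>\<bar>z\<bar> \<le> t / 2 + z\<^sup>2 / (2 t)\<close> with
  \<open>t = sqrt (a n)\<close>.\<close>

lemma L1_increment_bound:
  assumes ctrl: "drift_control C N"
  obtains K where "\<And>m n. N \<le> n \<Longrightarrow> n \<le> m \<Longrightarrow> (\<integral>\<omega>. \<bar>L m \<omega> - L n \<omega>\<bar> \<partial>M) \<le> K * sqrt (a n)"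
proof -
  obtain K where K: "\<And>m n. N \<le> n \<Longrightarrow> n \<le> m \<Longrightarrow> (\<integral>\<omega>. (L m \<omega> - L n \<omega>)\<^sup>2 \<partial>M) \<le> K * a n"
    using square_increment_bound[OF ctrl] by blast
  have N: "N \<ge> 1" using ctrl i_ge_1 by (auto simp: drift_control_def)
  have "(\<integral>\<omega>. \<bar>L m \<omega> - L n \<omega>\<bar> \<partial>M) \<le> ((1 + K) / 2) * sqrt (a n)" if nm: "N \<le> n" "n \<le> m" for m n
  proof -
    define t where "t = sqrt (a n)"
    have "a n > 0" using nm N by (intro a_pos) simp
    then have t: "t > 0" "t * t = a n" by (simp_all add: t_def)
    have Ln: "determined m (L n)" using determined_mono[OF determined_L nm(2)] .
    have int: "integrable M (\<lambda>\<omega>. (L m \<omega> - L n \<omega>)\<^sup>2)"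
      by (rule integrable_determined[OF determined_apply2[OF determined_L Ln]])
    have "(\<integral>\<omega>. \<bar>L m \<omega> - L n \<omega>\<bar> \<partial>M) \<le> (\<integral>\<omega>. t / 2 + (L m \<omega> - L n \<omega>)\<^sup>2 * (1 / (2 * t)) \<partial>M)"
    proof (rule integral_mono)
      show "integrable M (\<lambda>\<omega>. \<bar>L m \<omega> - L n \<omega>\<bar>)" using integrable_L by auto
      show "integrable M (\<lambda>\<omega>. t / 2 + (L m \<omega> - L n \<omega>)\<^sup>2 * (1 / (2 * t)))"
        using int by (intro Bochner_Integration.integrable_add integrable_mult_left) auto
      show "\<bar>L m \<omega> - L n \<omega>\<bar> \<le> t / 2 + (L m \<omega> - L n \<omega>)\<^sup>2 * (1 / (2 * t))" for \<omega>
      proof -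
        define z where "z = \<bar>L m \<omega> - L n \<omega>\<bar>"
        have "0 \<le> (z - t)\<^sup>2" by simp
        then have "2 * z * t \<le> t * t + z\<^sup>2" by (simp add: power2_eq_square algebra_simps)
        then have "z \<le> (t * t + z\<^sup>2) / (2 * t)" using t by (simp add: pos_le_divide_eq mult_ac)
        also have "\<dots> = t / 2 + z\<^sup>2 * (1 / (2 * t))" using t(1) by (simp add: add_divide_distrib)
        finally show ?thesis unfolding z_def by simp
      qed
    qed
    also have "\<dots> = t / 2 + (\<integral>\<omega>. (L m \<omega> - L n \<omega>)\<^sup>2 \<partial>M) * (1 / (2 * t))"
      using int by (subst Bochner_Integration.integral_add) (auto simp: prob_space)
    also have "\<dots> \<le> t / 2 + K * (t * t) * (1 / (2 * t))"
      using K[OF nm] t by (intro add_left_mono mult_right_mono) auto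
    also have "\<dots> = ((1 + K) / 2) * t" using t(1) by (simp add: field_simps)
    finally show ?thesis unfolding t_def .
  qed
  then show ?thesis by (rule that)
qed

text \<open>The noise does not change the mean, and the drift lowers it at most by the factor
  \<open>1 - C (a\<^sub>n - a\<^sub>n\<^sub>+\<^sub>1)\<close>. The product of these factors stays away from \<open>0\<close>, which will give the limit a
  positive mean.\<close>

lemma expectation_L_bounded_below:
  assumes ctrl: "drift_control C N"
  obtains \<kappa> where "\<kappa> > 0" "\<And>n. n \<ge> N \<Longrightarrow> \<kappa> \<le> (\<integral>\<omega>. L n \<omega> \<partial>M)"
proof -
  define m where "m n = (\<integral>\<omega>. L n \<omega> \<partial>M)" for n
  have N: "N \<ge> i" "N \<ge> 1" "C > 0" using ctrl i_ge_1 by (auto simp: drift_control_def)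
  have m_pos: "m n > 0" if "n \<ge> N" for n
    unfolding m_def using that N by (intro expectation_greater integrable_L AE_I2 L_pos) auto
  have decay: "m N * exp (- 2 * C * (a N - a n)) \<le> m n" if "n \<ge> N" for n
    using that
  proof (induction n rule: nat_induct_at_least)
    case base
    show ?case by simp
  next
    case (Suc n)
    let ?x = "C * (a n - a (Suc n))"
    have x: "0 \<le> ?x" "?x \<le> 1 / 2"
      using ctrl Suc.hyps a_decreasing[of n] N by (auto simp: drift_control_def)
    have int_drift: "integrable M (drift n)" by (rule integrable_determined[OF determined_drift])
    have int_noise: "integrable M (noise n)" by (rule integrable_determined[OF determined_noise])
    have noise: "(\<integral>\<omega>. noise n \<omega> \<partial>M) = 0"
      using expectation_mult_noise[OF _ determined_const[of n 1]] Suc.hyps N by simp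
    have "- ?x * m n = (\<integral>\<omega>. - ?x * L n \<omega> \<partial>M)"
      unfolding m_def by (rule integral_mult_right_zero[symmetric])
    also have "\<dots> \<le> (\<integral>\<omega>. drift n \<omega> \<partial>M)"
    proof (rule integral_mono[OF integrable_mult_right[OF integrable_L] int_drift])
      fix \<omega> assume "\<omega> \<in> space M"
      then have "\<bar>drift n \<omega>\<bar> \<le> ?x * L n \<omega>"
        using ctrl Suc.hyps unfolding drift_control_def by blast
      then show "- ?x * L n \<omega> \<le> drift n \<omega>" unfolding mult_minus_left by linarith
    qed
    finally have drift: "- ?x * m n \<le> (\<integral>\<omega>. drift n \<omega> \<partial>M)" .
    have "m (Suc n) = (\<integral>\<omega>. L n \<omega> + drift n \<omega> + (a (Suc n) + b (Suc n)) * noise n \<omega> \<partial>M)"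
      unfolding m_def using Suc.hyps N by (intro Bochner_Integration.integral_cong refl L_Suc) auto
    also have "\<dots> = m n + (\<integral>\<omega>. drift n \<omega> \<partial>M)"
      unfolding m_def using integrable_L int_drift int_noise noise by simp
    finally have "m (Suc n) \<ge> (1 - ?x) * m n" using drift by (simp add: algebra_simps)
    moreover have "exp (- (2 * ?x)) \<le> 1 - ?x"
    proof -
      have "1 \<le> (1 - ?x) * (1 + 2 * ?x)"
        using mult_left_mono[OF x(2) x(1)] x by (simp add: algebra_simps)
      also have "\<dots> \<le> (1 - ?x) * exp (2 * ?x)"
        using x by (intro mult_left_mono exp_ge_add_one_self) auto
      finally show ?thesis by (simp add: exp_minus inverse_eq_divide pos_divide_le_eq)
    qed
    ultimately have "exp (- (2 * ?x)) * m n \<le> m (Suc n)"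
      using mult_right_mono[of "exp (- (2 * ?x))" "1 - ?x" "m n"] m_pos[OF Suc.hyps] by linarith
    moreover have "exp (- (2 * ?x)) * (m N * exp (- 2 * C * (a N - a n))) \<le> exp (- (2 * ?x)) * m n"
      by (intro mult_left_mono Suc.IH) simp
    moreover have "exp (- (2 * ?x)) * (m N * exp (- 2 * C * (a N - a n))) = m N * exp (- 2 * C * (a N - a (Suc n)))"
      by (simp add: mult_exp_exp algebra_simps)
    ultimately show ?case by linarith
  qed
  show ?thesis
  proof
    show "m N * exp (- 2 * C * a N) > 0" using m_pos by simp
    show "m N * exp (- 2 * C * a N) \<le> (\<integral>\<omega>. L n \<omega> \<partial>M)" if "n \<ge> N" for n
    proof -
      have "a n > 0" using that N by (intro a_pos) simp
      then have "exp (- 2 * C * a N) \<le> exp (- 2 * C * (a N - a n))" using N by simp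
      then have "m N * exp (- 2 * C * a N) \<le> m N * exp (- 2 * C * (a N - a n))"
        using m_pos[of N] by (intro mult_left_mono) auto
      then show ?thesis using decay[OF that] unfolding m_def by linarith
    qed
  qed
qed

section \<open>Limits of the approximate martingale and of the degree\<close>

lemma powr_neg_alpha_minus_1: "x powr (- alpha - 1) = 1 / x powr (1 + alpha)" for x :: real
proof -
  have "- alpha - 1 = - (1 + alpha)" by simp
  then show ?thesis by (simp only: powr_minus_divide)
qed

text \<open>The limit is built as a telescoping series along the times \<open>s k = (k + N) ^ p\<close>. The rate
  \<open>K * sqrt (a n)\<close> carries over to the distance from the limit, which gives \<open>L\<^sup>1\<close> convergence and
  the positive mean; monotonicity of \<open>n powr (1 + alpha) * L n\<close> gives almost sure convergence.\<close>

lemma L_limit: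
  obtains Linf where "integrable M Linf" "AE \<omega> in M. (\<lambda>n. L n \<omega>) \<longlonglongrightarrow> Linf \<omega>"
    "(\<lambda>n. \<integral>\<omega>. \<bar>L n \<omega> - Linf \<omega>\<bar> \<partial>M) \<longlonglongrightarrow> 0" "0 < (\<integral>\<omega>. Linf \<omega> \<partial>M)"
proof -
  obtain C N where ctrl: "drift_control C N" using drift_control_exists by blast
  have N: "N \<ge> i" "N \<ge> 1" using ctrl i_ge_1 by (auto simp: drift_control_def)
  obtain K where K: "\<And>m n. N \<le> n \<Longrightarrow> n \<le> m \<Longrightarrow> (\<integral>\<omega>. \<bar>L m \<omega> - L n \<omega>\<bar> \<partial>M) \<le> K * sqrt (a n)"
    using L1_increment_bound[OF ctrl] by blast
  \<comment> \<open>The root of \<open>a (k ^ p)\<close> is \<open>k powr (- alpha * p / 2)\<close>; the exponent must be below \<open>-1\<close>.\<close>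
  obtain p :: nat where p: "p > 0" "alpha * real p > 4"
  proof -
    obtain q :: nat where "4 < real q * alpha" using reals_Archimedean3[OF alpha(1)] by blast
    then show ?thesis using that[of q] by (cases "q = 0") (auto simp: mult.commute)
  qed
  define s where "s k = (k + N) ^ p" for k
  have s_ge: "s k \<ge> k + N" for k unfolding s_def using p(1) N by (intro self_le_power) auto
  have s_mono: "s k \<le> s (Suc k)" for k unfolding s_def by (intro power_mono) auto
  define D where "D k \<omega> = L (s (Suc k)) \<omega> - L (s k) \<omega>" for k \<omega>
  have int_D: "integrable M (D k)" for k unfolding D_def using integrable_L by auto
  have "summable (\<lambda>k. real (k + N) powr - (alpha * real p / 2))"
    using p(2) by (intro summable_ignore_initial_segment[where f = "\<lambda>k. real k powr _"])
      (simp add: summable_real_powr_iff)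
  then have sum_bound: "summable (\<lambda>k. K * real (k + N) powr - (alpha * real p / 2))"
    by (rule summable_mult)
  have "sqrt (a (s k)) = real (k + N) powr - (alpha * real p / 2)" for k
  proof -
    have "a (s k) = (real (k + N) powr real p) powr - alpha"
      using N by (simp add: a_def s_def powr_realpow)
    also have "\<dots> = (real (k + N) powr - (alpha * real p / 2)) ^ 2"
      using N by (simp add: powr_powr powr_power mult.commute)
    finally show ?thesis by simp
  qed
  then have "(\<integral>\<omega>. norm (D k \<omega>) \<partial>M) \<le> K * real (k + N) powr - (alpha * real p / 2)" for k
    using K[of "s k" "s (Suc k)"] s_ge[of k] s_mono[of k] by (simp add: D_def)
  then have sum_E: "summable (\<lambda>k. \<integral>\<omega>. norm (D k \<omega>) \<partial>M)"
    by (intro summable_comparison_test'[OF sum_bound, of 0]) simp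
  have "(\<integral>\<^sup>+\<omega>. (\<Sum>k. ennreal (norm (D k \<omega>))) \<partial>M) = (\<Sum>k. \<integral>\<^sup>+\<omega>. ennreal (norm (D k \<omega>)) \<partial>M)"
    using int_D by (intro nn_integral_suminf) auto
  also have "\<dots> = (\<Sum>k. ennreal (\<integral>\<omega>. norm (D k \<omega>) \<partial>M))"
    using int_D by (intro suminf_cong nn_integral_eq_integral) auto
  also have "\<dots> \<noteq> \<infinity>" using sum_E by (simp add: suminf_ennreal2)
  finally have "AE \<omega> in M. (\<Sum>k. ennreal (norm (D k \<omega>))) \<noteq> \<infinity>"
    using int_D by (intro nn_integral_PInf_AE) auto
  then have AE_sum: "AE \<omega> in M. summable (\<lambda>k. norm (D k \<omega>))"
    by eventually_elim (intro summable_suminf_not_top, auto)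
  define Linf where "Linf \<omega> = L (s 0) \<omega> + (\<Sum>k. D k \<omega>)" for \<omega>
  \<comment> \<open>An integrable bound, uniform in \<open>k\<close>, for the distance of \<open>L (s k)\<close> from the limit.\<close>
  define g where "g \<omega> = \<bar>L (s 0) \<omega>\<bar> + (\<Sum>k. norm (D k \<omega>)) + \<bar>Linf \<omega>\<bar>" for \<omega>
  have int_l: "integrable M Linf"
    unfolding Linf_def by (intro Bochner_Integration.integrable_add integrable_L integrable_suminf int_D AE_sum sum_E)
  have int_g: "integrable M g"
    unfolding g_def using AE_sum sum_E int_D
    by (intro Bochner_Integration.integrable_add integrable_abs integrable_L int_l integrable_suminf) auto
  have telescope: "L (s k) \<omega> = L (s 0) \<omega> + (\<Sum>j<k. D j \<omega>)" for k \<omega>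
    by (induction k) (auto simp: D_def)
  have AE_s: "AE \<omega> in M. (\<lambda>k. L (s k) \<omega>) \<longlonglongrightarrow> Linf \<omega>"
    using AE_sum
  proof eventually_elim
    case (elim \<omega>)
    then have "(\<lambda>k. \<Sum>j<k. D j \<omega>) \<longlonglongrightarrow> (\<Sum>k. D k \<omega>)" by (rule summable_LIMSEQ[OF summable_norm_cancel])
    then have "(\<lambda>k. L (s 0) \<omega> + (\<Sum>j<k. D j \<omega>)) \<longlonglongrightarrow> Linf \<omega>"
      unfolding Linf_def by (intro tendsto_add tendsto_const)
    moreover have "(\<lambda>k. L (s k) \<omega>) = (\<lambda>k. L (s 0) \<omega> + (\<Sum>j<k. D j \<omega>))"
      by (rule ext) (rule telescope)
    ultimately show ?case by (simp only:)
  qed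
  have "(\<lambda>k. \<integral>\<omega>. \<bar>L (s k) \<omega> - Linf \<omega>\<bar> \<partial>M) \<longlonglongrightarrow> (\<integral>\<omega>. 0 \<partial>M)"
  proof (rule integral_dominated_convergence[where w = g])
    show "AE \<omega> in M. (\<lambda>k. \<bar>L (s k) \<omega> - Linf \<omega>\<bar>) \<longlonglongrightarrow> 0"
      using AE_s by eventually_elim (intro tendsto_rabs_zero, simp add: LIM_zero)
    show "AE \<omega> in M. norm \<bar>L (s k) \<omega> - Linf \<omega>\<bar> \<le> g \<omega>" for k
      using AE_sum
    proof eventually_elim
      case (elim \<omega>)
      have "\<bar>\<Sum>j<k. D j \<omega>\<bar> \<le> (\<Sum>j<k. norm (D j \<omega>))" using norm_sum[of "\<lambda>j. D j \<omega>"] by simp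
      also have "\<dots> \<le> (\<Sum>j. norm (D j \<omega>))" by (intro sum_le_suminf elim) auto
      finally show ?case unfolding telescope[of k] g_def real_norm_def by linarith
    qed
  qed (use int_l int_g integrable_L in auto)
  then have L1_s: "(\<lambda>k. \<integral>\<omega>. \<bar>L (s k) \<omega> - Linf \<omega>\<bar> \<partial>M) \<longlonglongrightarrow> 0" by simp
  have rate: "(\<integral>\<omega>. \<bar>L n \<omega> - Linf \<omega>\<bar> \<partial>M) \<le> K * sqrt (a n)" if n: "n \<ge> N" for n
  proof -
    have "(\<integral>\<omega>. \<bar>L n \<omega> - Linf \<omega>\<bar> \<partial>M) \<le> K * sqrt (a n) + (\<integral>\<omega>. \<bar>L (s k) \<omega> - Linf \<omega>\<bar> \<partial>M)" if "k \<ge> n" for k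
    proof -
      have "(\<integral>\<omega>. \<bar>L n \<omega> - Linf \<omega>\<bar> \<partial>M) \<le> (\<integral>\<omega>. \<bar>L (s k) \<omega> - L n \<omega>\<bar> + \<bar>L (s k) \<omega> - Linf \<omega>\<bar> \<partial>M)"
        using integrable_L int_l by (intro integral_mono) auto
      also have "\<dots> = (\<integral>\<omega>. \<bar>L (s k) \<omega> - L n \<omega>\<bar> \<partial>M) + (\<integral>\<omega>. \<bar>L (s k) \<omega> - Linf \<omega>\<bar> \<partial>M)"
        using integrable_L int_l by (intro Bochner_Integration.integral_add) auto
      finally show ?thesis using K[OF n, of "s k"] s_ge[of k] that by linarith
    qed
    then have "\<forall>\<^sub>F k in sequentially.
        (\<integral>\<omega>. \<bar>L n \<omega> - Linf \<omega>\<bar> \<partial>M) \<le> K * sqrt (a n) + (\<integral>\<omega>. \<bar>L (s k) \<omega> - Linf \<omega>\<bar> \<partial>M)"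
      unfolding eventually_sequentially by blast
    moreover have "(\<lambda>k. K * sqrt (a n) + (\<integral>\<omega>. \<bar>L (s k) \<omega> - Linf \<omega>\<bar> \<partial>M)) \<longlonglongrightarrow> K * sqrt (a n) + 0"
      by (intro tendsto_intros L1_s)
    ultimately show ?thesis using tendsto_lowerbound by force
  qed
  have "(\<lambda>n. K * sqrt (a n)) \<longlonglongrightarrow> K * sqrt 0" by (intro tendsto_intros a_tendsto_0)
  then have lim: "(\<lambda>n. K * sqrt (a n)) \<longlonglongrightarrow> 0" by simp
  have L1: "(\<lambda>n. \<integral>\<omega>. \<bar>L n \<omega> - Linf \<omega>\<bar> \<partial>M) \<longlonglongrightarrow> 0"
  proof (rule tendsto_sandwich[OF _ _ tendsto_const lim])
    show "\<forall>\<^sub>F n in sequentially. 0 \<le> (\<integral>\<omega>. \<bar>L n \<omega> - Linf \<omega>\<bar> \<partial>M)" by simp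
    show "\<forall>\<^sub>F n in sequentially. (\<integral>\<omega>. \<bar>L n \<omega> - Linf \<omega>\<bar> \<partial>M) \<le> K * sqrt (a n)"
      unfolding eventually_sequentially using rate by blast
  qed
  have AE: "AE \<omega> in M. (\<lambda>n. L n \<omega>) \<longlonglongrightarrow> Linf \<omega>"
    using AE_s AE_space
  proof eventually_elim
    case (elim \<omega>)
    \<comment> \<open>The increasing sequence \<open>n powr (1 + alpha) * L n\<close>.\<close>
    define f where "f n = real n * X n \<omega> + alpha * Theta n \<omega>" for n
    have L_f: "L n \<omega> = f n / real n powr (1 + alpha)" for n
    proof (cases "n = 0")
      case True
      then show ?thesis by (simp add: L_def a_def b_def)
    next
      case False
      then have n: "real n > 0" by simp
      have "real n powr - alpha = real n / real n powr (1 + alpha)"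
        using n by (simp add: powr_add powr_minus field_simps)
      moreover have "real n powr (- alpha - 1) = 1 / real n powr (1 + alpha)"
        by (rule powr_neg_alpha_minus_1)
      ultimately show ?thesis by (simp add: L_def a_def b_def f_def add_divide_distrib)
    qed
    have "(\<lambda>n. f n / real n powr (1 + alpha)) \<longlonglongrightarrow> Linf \<omega>"
    proof (rule tendsto_of_power_subsequence[where N = i and p = p])
      show "p > 0" by (rule p)
      show "0 \<le> 1 + alpha" using alpha(1) by simp
      show "0 \<le> f n" if "n \<ge> i" for n
        unfolding f_def using X_mono_pos(2)[OF that elim(2)] Theta_pos[OF that elim(2)] alpha(1)
        by (intro add_nonneg_nonneg mult_nonneg_nonneg) auto
      show "f m \<le> f n" if "i \<le> m" "m \<le> n" for m n
        using that(2)
      proof (induction n rule: dec_induct)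
        case base
        show ?case by simp
      next
        case (step n)
        have n: "i \<le> n" using that(1) step.hyps by simp
        have "real n * X n \<omega> \<le> real (Suc n) * X (Suc n) \<omega>"
          using X_mono_pos[OF n elim(2)] by (intro mult_mono) auto
        moreover have "alpha * Theta n \<omega> \<le> alpha * Theta (Suc n) \<omega>"
          using X_mono_pos(2)[of "Suc n" \<omega>] elim(2) n alpha(1) by (intro mult_left_mono) (auto simp: Theta_Suc)
        ultimately show ?case using step.IH by (simp add: f_def)
      qed
      have "(\<lambda>k. (\<lambda>k. L (k ^ p) \<omega>) (k + N)) \<longlonglongrightarrow> Linf \<omega>" using elim(1) by (simp add: s_def)
      then have "(\<lambda>k. L (k ^ p) \<omega>) \<longlonglongrightarrow> Linf \<omega>" by (rule LIMSEQ_offset)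
      then show "(\<lambda>k. f (k ^ p) / real (k ^ p) powr (1 + alpha)) \<longlonglongrightarrow> Linf \<omega>" unfolding L_f .
    qed
    then show ?case unfolding L_f .
  qed
  obtain \<kappa> where \<kappa>: "\<kappa> > 0" "\<And>n. n \<ge> N \<Longrightarrow> \<kappa> \<le> (\<integral>\<omega>. L n \<omega> \<partial>M)"
    using expectation_L_bounded_below[OF ctrl] by blast
  have "\<kappa> \<le> (\<integral>\<omega>. Linf \<omega> \<partial>M) + K * sqrt (a n)" if "n \<ge> N" for n
  proof -
    have "(\<integral>\<omega>. L n \<omega> \<partial>M) \<le> (\<integral>\<omega>. Linf \<omega> + \<bar>L n \<omega> - Linf \<omega>\<bar> \<partial>M)"
      using integrable_L int_l by (intro integral_mono) auto
    also have "\<dots> = (\<integral>\<omega>. Linf \<omega> \<partial>M) + (\<integral>\<omega>. \<bar>L n \<omega> - Linf \<omega>\<bar> \<partial>M)"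
      using integrable_L int_l by (intro Bochner_Integration.integral_add) auto
    finally show ?thesis using rate[OF that] \<kappa>(2)[OF that] by linarith
  qed
  then have "\<forall>\<^sub>F n in sequentially. \<kappa> \<le> (\<integral>\<omega>. Linf \<omega> \<partial>M) + K * sqrt (a n)"
    unfolding eventually_sequentially by blast
  moreover have "(\<lambda>n. (\<integral>\<omega>. Linf \<omega> \<partial>M) + K * sqrt (a n)) \<longlonglongrightarrow> (\<integral>\<omega>. Linf \<omega> \<partial>M) + 0"
    by (intro tendsto_intros lim)
  ultimately have "\<kappa> \<le> (\<integral>\<omega>. Linf \<omega> \<partial>M)" using tendsto_lowerbound by force
  then show ?thesis using that[OF int_l AE L1] \<kappa>(1) by simp
qed

definition W :: "nat \<Rightarrow> 'a \<Rightarrow> real" where "W n \<omega> = Theta n \<omega> / real n powr (1 + alpha)"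

text \<open>The error made when \<open>l / (1 + 2 \<alpha>)\<close> is inserted as a constant solution into the recursion for \<open>W\<close>,
  per unit of that constant and multiplied by \<open>Suc n\<close>.\<close>

definition W_residue :: "nat \<Rightarrow> real" where
  "W_residue n = real (Suc n) * (1 + alpha / real (Suc n) - (real n / real (Suc n)) powr (1 + alpha)
      - (1 + 2 * alpha) / real (Suc n))"

lemma W_residue_tendsto_0: "W_residue \<longlonglongrightarrow> 0"
  unfolding W_residue_def by (rule theta_recursion_coefficient[OF alpha(1,2)])

lemma L_eq_W: "n \<ge> 1 \<Longrightarrow> L n \<omega> = real n powr - alpha * X n \<omega> + alpha * W n \<omega>"
  unfolding L_def a_def b_def W_def
  by (simp add: powr_neg_alpha_minus_1)

text \<open>Substituting \<open>X = n powr \<alpha> * (L - \<alpha> W)\<close> into \<open>\<Theta>\<^sub>n\<^sub>+\<^sub>1 = \<Theta>\<^sub>n + X\<^sub>n\<^sub>+\<^sub>1\<close> gives, with \<open>S = n + 1\<close> and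
  \<open>\<rho> = (n / S) powr (1 + \<alpha>)\<close>, the identity \<open>(S + \<alpha>) W\<^sub>n\<^sub>+\<^sub>1 = S \<rho> W\<^sub>n + L\<^sub>n\<^sub>+\<^sub>1\<close>. It contracts the error,
  because \<open>S \<rho> \<le> n\<close>.\<close>

lemma W_error_recursion:
  assumes "n \<ge> i"
  shows "real (Suc n) * \<bar>W (Suc n) \<omega> - l / (1 + 2 * alpha)\<bar> \<le> real n * \<bar>W n \<omega> - l / (1 + 2 * alpha)\<bar> +
    (\<bar>L (Suc n) \<omega> - l\<bar> + \<bar>W_residue n\<bar> * \<bar>l\<bar> / (1 + 2 * alpha))"
proof -
  define q where "q = 1 + 2 * alpha"
  define w where "w = l / q"
  have q: "q > 0" "l = q * w" using alpha(1) by (simp_all add: q_def w_def)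
  have n: "n \<ge> 1" using assms i_ge_1 by simp
  define S where "S = real (Suc n)"
  define \<rho> where "\<rho> = (real n / S) powr (1 + alpha)"
  have S: "S > 0" "real n / S < 1" "S * (real n / S) = real n" by (simp_all add: S_def)
  have \<rho>: "0 \<le> \<rho>" "S * \<rho> \<le> real n"
  proof -
    show "0 \<le> \<rho>" by (simp add: \<rho>_def)
    have "\<rho> \<le> (real n / S) powr 1"
      unfolding \<rho>_def using alpha(1) n S by (intro powr_mono') auto
    then have "\<rho> \<le> real n / S" using n S by simp
    then have "S * \<rho> \<le> S * (real n / S)" using S by (intro mult_left_mono) auto
    then show "S * \<rho> \<le> real n" using S by simp
  qed
  have "real (Suc n) powr (1 + alpha) = S * S powr alpha" using S by (simp add: powr_add S_def)
  have "W (Suc n) \<omega> = \<rho> * W n \<omega> + S powr - alpha * X (Suc n) \<omega> / S"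
  proof -
    have "\<rho> * W n \<omega> = Theta n \<omega> / S powr (1 + alpha)"
      unfolding \<rho>_def W_def using n S by (simp add: powr_divide)
    moreover have "S powr - alpha * X (Suc n) \<omega> / S = X (Suc n) \<omega> / S powr (1 + alpha)"
      using S by (simp add: powr_add powr_minus field_simps)
    ultimately show ?thesis
      unfolding W_def S_def[symmetric] using assms by (simp add: Theta_Suc add_divide_distrib)
  qed
  moreover have "S powr - alpha * X (Suc n) \<omega> = L (Suc n) \<omega> - alpha * W (Suc n) \<omega>"
    using L_eq_W[of "Suc n" \<omega>] by (simp add: S_def)
  ultimately have "W (Suc n) \<omega> = \<rho> * W n \<omega> + (L (Suc n) \<omega> - alpha * W (Suc n) \<omega>) / S" by simp
  then have rec: "(S + alpha) * W (Suc n) \<omega> = S * \<rho> * W n \<omega> + L (Suc n) \<omega>"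
    using S(1) by (simp add: field_simps)
  have res: "W_residue n = S + alpha - S * \<rho> - q"
    unfolding W_residue_def S_def[symmetric] \<rho>_def[symmetric] q_def[symmetric]
    using S(1) by (simp add: right_diff_distrib distrib_left)
  have "(S + alpha) * (W (Suc n) \<omega> - w) = S * \<rho> * (W n \<omega> - w) + ((L (Suc n) \<omega> - l) - W_residue n * w)"
    unfolding right_diff_distrib[of "S + alpha"] rec res q(2) by (simp add: algebra_simps)
  then have "\<bar>(S + alpha) * (W (Suc n) \<omega> - w)\<bar> \<le>
      \<bar>S * \<rho> * (W n \<omega> - w)\<bar> + (\<bar>L (Suc n) \<omega> - l\<bar> + \<bar>W_residue n * w\<bar>)" by linarith
  then have "(S + alpha) * \<bar>W (Suc n) \<omega> - w\<bar> \<le>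
      S * \<rho> * \<bar>W n \<omega> - w\<bar> + (\<bar>L (Suc n) \<omega> - l\<bar> + \<bar>W_residue n\<bar> * \<bar>w\<bar>)"
    using S(1) \<rho>(1) alpha(1) by (simp add: abs_mult)
  moreover have "S * \<bar>W (Suc n) \<omega> - w\<bar> \<le> (S + alpha) * \<bar>W (Suc n) \<omega> - w\<bar>"
    using alpha(1) by (intro mult_right_mono) auto
  moreover have "S * \<rho> * \<bar>W n \<omega> - w\<bar> \<le> real n * \<bar>W n \<omega> - w\<bar>"
    using \<rho>(2) by (intro mult_right_mono) auto
  moreover have "\<bar>w\<bar> = \<bar>l\<bar> / q" using q(1) by (simp add: w_def)
  ultimately show ?thesis unfolding S_def[symmetric] w_def[symmetric] q_def[symmetric] by simp
qed

text \<open>The distance of the scaled degree from \<open>\<zeta>\<close> is at most the error of \<open>L\<close> plus \<open>\<alpha>\<close> times the error of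
  \<open>W\<close>, plus the contribution of the shift by \<open>\<delta>\<close>. All three vanish almost surely and in mean.\<close>

lemma degree_limit:
  obtains \<zeta> where "integrable M \<zeta>" "0 < (\<integral>\<omega>. \<zeta> \<omega> \<partial>M)"
    "AE \<omega> in M. (\<lambda>n. real n powr - alpha * real (vdeg (T n \<omega>) i)) \<longlonglongrightarrow> \<zeta> \<omega>"
    "\<And>n. integrable M (\<lambda>\<omega>. real n powr - alpha * real (vdeg (T n \<omega>) i))"
    "(\<lambda>n. \<integral>\<omega>. \<bar>real n powr - alpha * real (vdeg (T n \<omega>) i) - \<zeta> \<omega>\<bar> \<partial>M) \<longlonglongrightarrow> 0"
proof -
  obtain Linf where l: "integrable M Linf" "AE \<omega> in M. (\<lambda>n. L n \<omega>) \<longlonglongrightarrow> Linf \<omega>"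
    "(\<lambda>n. \<integral>\<omega>. \<bar>L n \<omega> - Linf \<omega>\<bar> \<partial>M) \<longlonglongrightarrow> 0" "0 < (\<integral>\<omega>. Linf \<omega> \<partial>M)"
    using L_limit by blast
  define q where "q = 1 + 2 * alpha"
  have q: "q > 0" using alpha(1) by (simp add: q_def)
  define \<zeta> where "\<zeta> \<omega> = (1 + alpha) / q * Linf \<omega>" for \<omega>
  define Y where "Y n \<omega> = real n powr - alpha * real (vdeg (T n \<omega>) i)" for n \<omega>
  have int_W: "integrable M (W n)" for n
    unfolding W_def by (rule integrable_determined[OF determined_apply[OF determined_Theta]])
  have int_Y: "integrable M (Y n)" for n
    unfolding Y_def by (rule integrable_determined[OF determined_apply[OF determined_T[OF order_refl]]])
  have int_z: "integrable M \<zeta>" unfolding \<zeta>_def by (rule integrable_mult_right[OF l(1)])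
  have pos: "0 < (\<integral>\<omega>. \<zeta> \<omega> \<partial>M)"
    unfolding \<zeta>_def integral_mult_right_zero using l(4) alpha(1) q by (intro mult_pos_pos) auto
  have Y_error: "\<bar>Y n \<omega> - \<zeta> \<omega>\<bar> \<le> \<bar>L n \<omega> - Linf \<omega>\<bar> + alpha * \<bar>W n \<omega> - Linf \<omega> / q\<bar> + \<bar>\<delta>\<bar> * a n" if "n \<ge> 1" for n \<omega>
  proof -
    have "\<zeta> \<omega> = Linf \<omega> - alpha * (Linf \<omega> / q)"
      using q unfolding \<zeta>_def by (simp add: field_simps) (simp add: q_def algebra_simps)
    moreover have "Y n \<omega> = L n \<omega> - alpha * W n \<omega> - \<delta> * a n"
      unfolding L_eq_W[OF that] Y_def X_def a_def by (simp add: algebra_simps)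
    ultimately have "Y n \<omega> - \<zeta> \<omega> = (L n \<omega> - Linf \<omega>) - alpha * (W n \<omega> - Linf \<omega> / q) - \<delta> * a n"
      by (simp add: algebra_simps)
    moreover have "\<bar>alpha * (W n \<omega> - Linf \<omega> / q)\<bar> = alpha * \<bar>W n \<omega> - Linf \<omega> / q\<bar>"
      using alpha(1) by (simp add: abs_mult)
    moreover have "\<bar>\<delta> * a n\<bar> = \<bar>\<delta>\<bar> * a n" using a_pos[OF that] by (simp add: abs_mult)
    moreover have "\<bar>x - y - z\<bar> \<le> \<bar>x\<bar> + \<bar>y\<bar> + \<bar>z\<bar>" for x y z :: real by linarith
    ultimately show ?thesis by metis
  qed
  have res: "(\<lambda>n. \<bar>W_residue n\<bar> * c / q) \<longlonglongrightarrow> 0" for c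
    by (intro tendsto_divide_zero tendsto_mult_left_zero tendsto_rabs_zero W_residue_tendsto_0)
  have da: "(\<lambda>n. \<bar>\<delta>\<bar> * a n) \<longlonglongrightarrow> 0" by (intro tendsto_mult_right_zero a_tendsto_0)
  have ge1: "\<forall>\<^sub>F n in sequentially. n \<ge> (1::nat)" by (rule eventually_ge_at_top)
  have AE_Y: "AE \<omega> in M. (\<lambda>n. Y n \<omega>) \<longlonglongrightarrow> \<zeta> \<omega>"
    using l(2)
  proof eventually_elim
    case (elim \<omega>)
    have L0: "(\<lambda>n. \<bar>L n \<omega> - Linf \<omega>\<bar>) \<longlonglongrightarrow> 0" using elim by (intro tendsto_rabs_zero LIM_zero)
    have W0: "(\<lambda>n. \<bar>W n \<omega> - Linf \<omega> / q\<bar>) \<longlonglongrightarrow> 0"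
    proof (rule averaging_recursion_tendsto_0)
      show "real (Suc n) * \<bar>W (Suc n) \<omega> - Linf \<omega> / q\<bar> \<le> real n * \<bar>W n \<omega> - Linf \<omega> / q\<bar> +
          (\<bar>L (Suc n) \<omega> - Linf \<omega>\<bar> + \<bar>W_residue n\<bar> * \<bar>Linf \<omega>\<bar> / q)" if "n \<ge> i" for n
        unfolding q_def by (rule W_error_recursion[OF that])
      show "(\<lambda>n. \<bar>L (Suc n) \<omega> - Linf \<omega>\<bar> + \<bar>W_residue n\<bar> * \<bar>Linf \<omega>\<bar> / q) \<longlonglongrightarrow> 0"
        by (rule tendsto_add_zero[OF LIMSEQ_Suc[OF L0] res])
    qed auto
    have bound: "(\<lambda>n. \<bar>L n \<omega> - Linf \<omega>\<bar> + alpha * \<bar>W n \<omega> - Linf \<omega> / q\<bar> + \<bar>\<delta>\<bar> * a n) \<longlonglongrightarrow> 0"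
      by (intro tendsto_add_zero L0 tendsto_mult_right_zero W0 da)
    have "(\<lambda>n. Y n \<omega> - \<zeta> \<omega>) \<longlonglongrightarrow> 0"
      by (rule Lim_null_comparison[OF _ bound]) (use ge1 in eventually_elim, simp add: Y_error)
    then show ?case by (rule LIM_zero_cancel)
  qed
  have W0: "(\<lambda>n. \<integral>\<omega>. \<bar>W n \<omega> - Linf \<omega> / q\<bar> \<partial>M) \<longlonglongrightarrow> 0"
  proof (rule averaging_recursion_tendsto_0)
    let ?c = "\<integral>\<omega>. \<bar>Linf \<omega>\<bar> \<partial>M"
    show "real (Suc n) * (\<integral>\<omega>. \<bar>W (Suc n) \<omega> - Linf \<omega> / q\<bar> \<partial>M) \<le> real n * (\<integral>\<omega>. \<bar>W n \<omega> - Linf \<omega> / q\<bar> \<partial>M) +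
        ((\<integral>\<omega>. \<bar>L (Suc n) \<omega> - Linf \<omega>\<bar> \<partial>M) + \<bar>W_residue n\<bar> * ?c / q)" if "n \<ge> i" for n
    proof -
      have i1: "integrable M (\<lambda>\<omega>. \<bar>W k \<omega> - Linf \<omega> / q\<bar>)" for k using int_W l(1) by auto
      have i2: "integrable M (\<lambda>\<omega>. \<bar>L k \<omega> - Linf \<omega>\<bar>)" for k using integrable_L l(1) by auto
      have i3: "integrable M (\<lambda>\<omega>. \<bar>W_residue n\<bar> * \<bar>Linf \<omega>\<bar> / q)" using l(1) by auto
      have "(\<integral>\<omega>. real (Suc n) * \<bar>W (Suc n) \<omega> - Linf \<omega> / q\<bar> \<partial>M) \<le>
          (\<integral>\<omega>. real n * \<bar>W n \<omega> - Linf \<omega> / q\<bar> + (\<bar>L (Suc n) \<omega> - Linf \<omega>\<bar> + \<bar>W_residue n\<bar> * \<bar>Linf \<omega>\<bar> / q) \<partial>M)"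
        using W_error_recursion[OF that] unfolding q_def[symmetric]
        by (intro integral_mono Bochner_Integration.integrable_add integrable_mult_right i1 i2 i3)
      also have "\<dots> = (\<integral>\<omega>. real n * \<bar>W n \<omega> - Linf \<omega> / q\<bar> \<partial>M) +
          ((\<integral>\<omega>. \<bar>L (Suc n) \<omega> - Linf \<omega>\<bar> \<partial>M) + (\<integral>\<omega>. \<bar>W_residue n\<bar> * \<bar>Linf \<omega>\<bar> / q \<partial>M))"
        by (subst Bochner_Integration.integral_add Bochner_Integration.integral_add[OF i2 i3],
            (intro Bochner_Integration.integrable_add integrable_mult_right i1 i2 i3)+)
           (subst Bochner_Integration.integral_add[OF i2 i3], rule refl)
      finally show ?thesis by (simp only: integral_mult_right_zero integral_divide_zero)
    qed
    show "(\<lambda>n. (\<integral>\<omega>. \<bar>L (Suc n) \<omega> - Linf \<omega>\<bar> \<partial>M) + \<bar>W_residue n\<bar> * ?c / q) \<longlonglongrightarrow> 0"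
      by (rule tendsto_add_zero[OF LIMSEQ_Suc[OF l(3)] res])
  qed simp
  have "(\<lambda>n. \<integral>\<omega>. \<bar>Y n \<omega> - \<zeta> \<omega>\<bar> \<partial>M) \<longlonglongrightarrow> 0"
  proof (rule Lim_null_comparison)
    show "(\<lambda>n. (\<integral>\<omega>. \<bar>L n \<omega> - Linf \<omega>\<bar> \<partial>M) + alpha * (\<integral>\<omega>. \<bar>W n \<omega> - Linf \<omega> / q\<bar> \<partial>M) + \<bar>\<delta>\<bar> * a n) \<longlonglongrightarrow> 0"
      by (intro tendsto_add_zero l(3) tendsto_mult_right_zero W0 da)
    show "\<forall>\<^sub>F n in sequentially. norm (\<integral>\<omega>. \<bar>Y n \<omega> - \<zeta> \<omega>\<bar> \<partial>M) \<le>
        (\<integral>\<omega>. \<bar>L n \<omega> - Linf \<omega>\<bar> \<partial>M) + alpha * (\<integral>\<omega>. \<bar>W n \<omega> - Linf \<omega> / q\<bar> \<partial>M) + \<bar>\<delta>\<bar> * a n"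
      using ge1
    proof eventually_elim
      case (elim n)
      have i1: "integrable M (\<lambda>\<omega>. alpha * \<bar>W n \<omega> - Linf \<omega> / q\<bar>)" using int_W l(1) by auto
      have i2: "integrable M (\<lambda>\<omega>. \<bar>L n \<omega> - Linf \<omega>\<bar>)" using integrable_L l(1) by auto
      have "(\<integral>\<omega>. \<bar>Y n \<omega> - \<zeta> \<omega>\<bar> \<partial>M) \<le>
          (\<integral>\<omega>. \<bar>L n \<omega> - Linf \<omega>\<bar> + alpha * \<bar>W n \<omega> - Linf \<omega> / q\<bar> + \<bar>\<delta>\<bar> * a n \<partial>M)"
        using int_Y int_z i1 i2 Y_error[OF elim] by (intro integral_mono) auto
      also have "\<dots> = (\<integral>\<omega>. \<bar>L n \<omega> - Linf \<omega>\<bar> \<partial>M) + (\<integral>\<omega>. alpha * \<bar>W n \<omega> - Linf \<omega> / q\<bar> \<partial>M) + \<bar>\<delta>\<bar> * a n"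
        using i1 i2 by (subst Bochner_Integration.integral_add) (auto simp: prob_space)
      finally show ?case by simp
    qed
  qed
  then show ?thesis using that[OF int_z pos] AE_Y int_Y unfolding Y_def by blast
qed

end

theorem theorem2p5:
  fixes M :: "'a measure" and \<delta> :: real and T :: "nat \<Rightarrow> 'a \<Rightarrow> nat set set" and i :: nat
  assumes "\<delta> > -1"
    and "self_reinforced_pa_trees M \<delta> T"
    and "i \<ge> 1"
  shows "\<exists>\<zeta> :: 'a \<Rightarrow> real. integrable M \<zeta> \<and> 0 < (\<integral>\<omega>. \<zeta> \<omega> \<partial>M) \<and>
    (AE \<omega> in M. (\<lambda>n. real n powr (- 1 / phi \<delta>) * real (vdeg (T n \<omega>) i)) \<longlonglongrightarrow> \<zeta> \<omega>) \<and>
    (\<forall>n. integrable M (\<lambda>\<omega>. real n powr (- 1 / phi \<delta>) * real (vdeg (T n \<omega>) i))) \<and>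
    (\<lambda>n. \<integral>\<omega>. \<bar>real n powr (- 1 / phi \<delta>) * real (vdeg (T n \<omega>) i) - \<zeta> \<omega>\<bar> \<partial>M) \<longlonglongrightarrow> 0"
proof -
  interpret self_reinforced_pa_trees M \<delta> T by (rule assms(2))
  interpret observed_vertex M \<delta> T i by unfold_locales (use assms in auto)
  have exponent: "- 1 / phi \<delta> = - alpha" by (simp add: alpha_def)
  show ?thesis unfolding exponent by (rule degree_limit) blast
qed

end
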